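(* Let $n$ be a power of an odd prime, $q = n^2$, $r = (n+1)/2$, let $V$ be a $2$-dimensional vector space over $\mathbb{F}_q$, $V^* = V\setminus\{0\}$, $B$ a nondegenerate symplectic (alternating) bilinear form on $V$, and $R$ the subgroup of index $r$ in $\mathbb{F}_q^*$. Let $\Gamma^{(n)}$ be the graph with vertex set $\{Ru : u \in V^*\}$ (where $Ru=\{\rho u:\rho\in R\}$) and with $Ru$ adjacent to $Rv$ iff $B(u,v)\in R$. Then $\Gamma^{(n)}$ is connected and locally $n \times n$ grid, every $\mu$-graph of $\Gamma^{(n)}$ has order exactly $2(n-1)$, $|V(\Gamma^{(n)})| = (n^2+1)(n+1)/2$, $\operatorname{diam}(\Gamma^{(n)}) = 3$, and $\Gamma^{(n)}$ is a distance-regular antipodal $((n+1)/2)$-cover of $K_{n^2+1}$ with intersection array $(n^2,(n-1)^2,1;1,2(n-1),n^2)$. Furthermore each $\mu$-graph of $\Gamma^{(n)}$ is either connected or a union of cycles of equal length.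
   Context: All graphs are finite, simple and undirected. A graph is locally $n\times n$ grid if the induced subgraph on every vertex neighbourhood is isomorphic to $K_n\square K_n$ (vertices $(i,j)$, $1\le i,j\le n$, adjacent iff they agree in exactly one coordinate). For vertices $x,y$ at distance $2$, the $\mu$-graph is the induced subgraph on the set of common neighbours of $x$ and $y$. A connected graph of diameter $D$ is distance-regular with intersection array $(b_0,\dots,b_{D-1};c_1,\dots,c_D)$ if for all $x,y$ at distance $i$, $y$ has exactly $b_i$ neighbours at distance $i+1$ from $x$ and $c_i$ neighbours at distance $i-1$ from $x$. A distance-regular graph of diameter $3$ is an antipodal $r$-cover of $K_N$ if "equal or at distance $3$" is an equivalence relation with all classes of size $r$ and the quotient graph on the $N$ classes is $K_N$. *)

theory Defs
  imports
    "HOL-Algebra.Coset"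
    "HOL-Computational_Algebra.Primes"
    "HOL-Library.Extended_Nat"
begin

section \<open>Graphs\<close>

datatype 'v graph = Graph (verts: "'v set") (adj: "'v \<Rightarrow> 'v \<Rightarrow> bool")

text \<open>Adjacency holds only between vertices, so that iterating \<open>adj G\<close> describes walks in \<open>G\<close>.\<close>

definition simple_graph :: "'v graph \<Rightarrow> bool" where
  "simple_graph G \<longleftrightarrow>
     finite (verts G) \<and>
     (\<forall>x y. adj G x y \<longrightarrow> x \<in> verts G \<and> y \<in> verts G) \<and>
     (\<forall>x y. adj G x y \<longrightarrow> adj G y x) \<and>
     (\<forall>x. \<not> adj G x x)"

definition nbhd :: "'v graph \<Rightarrow> 'v \<Rightarrow> 'v set" where
  "nbhd G x = {y \<in> verts G. adj G x y}"

definition induced :: "'v graph \<Rightarrow> 'v set \<Rightarrow> 'v graph" where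
  "induced G S = Graph (verts G \<inter> S) (\<lambda>x y. x \<in> S \<and> y \<in> S \<and> adj G x y)"

definition graph_iso :: "'v graph \<Rightarrow> 'w graph \<Rightarrow> bool" where
  "graph_iso G H \<longleftrightarrow>
     (\<exists>f. bij_betw f (verts G) (verts H) \<and>
          (\<forall>x\<in>verts G. \<forall>y\<in>verts G. adj G x y \<longleftrightarrow> adj H (f x) (f y)))"

definition complete_graph :: "nat \<Rightarrow> nat graph" where
  "complete_graph N = Graph {1..N} (\<lambda>i j. i \<in> {1..N} \<and> j \<in> {1..N} \<and> i \<noteq> j)"

text \<open>The Cartesian product of two complete graphs on \<open>n\<close> vertices: the pairs are
  adjacent iff they agree in exactly one coordinate.\<close>

definition grid_graph :: "nat \<Rightarrow> (nat \<times> nat) graph" where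
  "grid_graph n = Graph ({1..n} \<times> {1..n})
     (\<lambda>(i, j) (k, l). i \<in> {1..n} \<and> j \<in> {1..n} \<and> k \<in> {1..n} \<and> l \<in> {1..n} \<and>
        ((i = k) \<noteq> (j = l)))"

definition cycle_graph :: "nat \<Rightarrow> nat graph" where
  "cycle_graph l = Graph {..<l}
     (\<lambda>i j. i < l \<and> j < l \<and> (j = (i + 1) mod l \<or> i = (j + 1) mod l))"

definition connected_graph :: "'v graph \<Rightarrow> bool" where
  "connected_graph G \<longleftrightarrow>
     verts G \<noteq> {} \<and> (\<forall>x\<in>verts G. \<forall>y\<in>verts G. (adj G)\<^sup>*\<^sup>* x y)"

text \<open>\<open>(adj G ^^ k) x y\<close> says that there is a walk of length \<open>k\<close> from \<open>x\<close> to \<open>y\<close>; the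
  distance is \<open>\<infinity>\<close> if there is no walk.\<close>

definition gdist :: "'v graph \<Rightarrow> 'v \<Rightarrow> 'v \<Rightarrow> enat" where
  "gdist G x y = (INF k \<in> {k. (adj G ^^ k) x y}. enat k)"

definition diameter :: "'v graph \<Rightarrow> enat" where
  "diameter G = (SUP x \<in> verts G. SUP y \<in> verts G. gdist G x y)"

definition components :: "'v graph \<Rightarrow> 'v set set" where
  "components G = (\<lambda>x. {y \<in> verts G. (adj G)\<^sup>*\<^sup>* x y}) ` verts G"

definition union_of_cycles :: "'v graph \<Rightarrow> nat \<Rightarrow> bool" where
  "union_of_cycles G l \<longleftrightarrow>
     l \<ge> 3 \<and> (\<forall>C\<in>components G. graph_iso (induced G C) (cycle_graph l))"

definition locally_grid :: "'v graph \<Rightarrow> nat \<Rightarrow> bool" where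
  "locally_grid G n \<longleftrightarrow> (\<forall>x\<in>verts G. graph_iso (induced G (nbhd G x)) (grid_graph n))"

text \<open>Used below only for \<open>x\<close> and \<open>y\<close> at distance 2.\<close>

definition mu_graph :: "'v graph \<Rightarrow> 'v \<Rightarrow> 'v \<Rightarrow> 'v graph" where
  "mu_graph G x y = induced G (nbhd G x \<inter> nbhd G y)"

text \<open>The intersection array is \<open>(b\<^sub>0, \<dots>, b\<^bsub>D-1\<^esub>; c\<^sub>1, \<dots>, c\<^sub>D)\<close>, so \<open>c\<^sub>i\<close> is
  the entry of \<open>cs\<close> at position \<open>i - 1\<close>.\<close>

definition distance_regular :: "'v graph \<Rightarrow> nat list \<Rightarrow> nat list \<Rightarrow> bool" where
  "distance_regular G bs cs \<longleftrightarrow>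
     connected_graph G \<and>
     diameter G = enat (length bs) \<and> length cs = length bs \<and>
     (\<forall>x\<in>verts G. \<forall>y\<in>verts G. \<forall>i. gdist G x y = enat i \<longrightarrow>
        (i < length bs \<longrightarrow> card {z \<in> nbhd G y. gdist G x z = enat (i + 1)} = bs ! i) \<and>
        (1 \<le> i \<longrightarrow> card {z \<in> nbhd G y. gdist G x z = enat (i - 1)} = cs ! (i - 1)))"

definition antipodal_rel :: "'v graph \<Rightarrow> ('v \<times> 'v) set" where
  "antipodal_rel G =
     {(x, y). x \<in> verts G \<and> y \<in> verts G \<and> (x = y \<or> gdist G x y = 3)}"

definition quotient_graph :: "'v graph \<Rightarrow> ('v \<times> 'v) set \<Rightarrow> 'v set graph" where
  "quotient_graph G E = Graph (verts G // E)
     (\<lambda>X Y. X \<in> verts G // E \<and> Y \<in> verts G // E \<and> X \<noteq> Y \<and> (\<exists>x\<in>X. \<exists>y\<in>Y. adj G x y))"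

definition antipodal_cover :: "'v graph \<Rightarrow> nat \<Rightarrow> nat \<Rightarrow> bool" where
  "antipodal_cover G r N \<longleftrightarrow>
     (\<exists>bs cs. distance_regular G bs cs) \<and> diameter G = 3 \<and>
     equiv (verts G) (antipodal_rel G) \<and>
     (\<forall>X \<in> verts G // antipodal_rel G. card X = r) \<and>
     graph_iso (quotient_graph G (antipodal_rel G)) (complete_graph N)"

section \<open>The graph of a symplectic plane\<close>

definition mult_group :: "'k::field monoid" where
  "mult_group = \<lparr>carrier = UNIV - {0}, monoid.mult = (*), one = 1\<rparr>"

definition symplectic_form ::
    "('k::field \<Rightarrow> 'v::ab_group_add \<Rightarrow> 'v) \<Rightarrow> ('v \<Rightarrow> 'v \<Rightarrow> 'k) \<Rightarrow> bool" where
  "symplectic_form scale B \<longleftrightarrow>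
     (\<forall>u. Vector_Spaces.linear scale (*) (\<lambda>v. B u v)) \<and>
     (\<forall>v. Vector_Spaces.linear scale (*) (\<lambda>u. B u v)) \<and>
     (\<forall>u. B u u = 0) \<and>
     (\<forall>u. (\<forall>v. B u v = 0) \<longrightarrow> u = 0)"

definition orbit :: "('k \<Rightarrow> 'v \<Rightarrow> 'v) \<Rightarrow> 'k set \<Rightarrow> 'v \<Rightarrow> 'v set" where
  "orbit scale R u = (\<lambda>\<rho>. scale \<rho> u) ` R"

text \<open>Adjacency does not depend on the representatives \<open>u\<close> and \<open>v\<close>; see the lemma below.\<close>

definition Gamma ::
    "('k \<Rightarrow> 'v \<Rightarrow> 'v) \<Rightarrow> ('v \<Rightarrow> 'v \<Rightarrow> 'k) \<Rightarrow> 'k set \<Rightarrow> 'v::ab_group_add set graph" where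
  "Gamma scale B R = Graph (orbit scale R ` (UNIV - {0}))
     (\<lambda>X Y. \<exists>u v. u \<noteq> 0 \<and> v \<noteq> 0 \<and> X = orbit scale R u \<and> Y = orbit scale R v \<and> B u v \<in> R)"

lemma adj_Gamma_orbit_iff:
  fixes scale :: "'k::field \<Rightarrow> 'v::ab_group_add \<Rightarrow> 'v"
  assumes B: "symplectic_form scale B" and R: "subgroup R mult_group"
    and "u \<noteq> 0" "v \<noteq> 0"
  shows "adj (Gamma scale B R) (orbit scale R u) (orbit scale R v) \<longleftrightarrow> B u v \<in> R"
proof
  assume "B u v \<in> R"
  then show "adj (Gamma scale B R) (orbit scale R u) (orbit scale R v)"
    using assms(3,4) by (auto simp: Gamma_def)
next
  assume "adj (Gamma scale B R) (orbit scale R u) (orbit scale R v)"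
  then obtain u' v' where eq: "orbit scale R u = orbit scale R u'"
      "orbit scale R v = orbit scale R v'" and uv': "B u' v' \<in> R"
    by (auto simp: Gamma_def)
  have R1: "1 \<in> R" and Rm: "a * b \<in> R" if "a \<in> R" "b \<in> R" for a b
    using subgroup.one_closed[OF R] subgroup.m_closed[OF R] that by (auto simp: mult_group_def)
  interpret vector_space scale
    using B by (auto simp: symplectic_form_def Vector_Spaces.linear_def)
  have self: "w \<in> orbit scale R w" for w
    using R1 subgroup.one_closed[OF R]
    by (auto simp: orbit_def mult_group_def intro!: image_eqI[of _ _ 1])
  obtain a b where a: "a \<in> R" "u = scale a u'" and b: "b \<in> R" "v = scale b v'"
    using self[of u] self[of v] eq by (auto simp: orbit_def)
  have "B u v = a * (b * B u' v')"
    using B unfolding symplectic_form_def a b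
    by (metis Vector_Spaces.linear_def module_hom.scale)
  then show "B u v \<in> R" using a b uv' Rm by metis
qed

end

theory Submission
  imports Defs "HOL-Computational_Algebra.Polynomial" "HOL-Number_Theory.Residues"
begin

text \<open>
  Let \<open>\<sigma> x = x ^ n\<close>, the involution of the field with \<open>n\<^sup>2\<close> elements, and let \<open>F\<close> and \<open>E\<close> be its
  eigenspaces for \<open>1\<close> and \<open>-1\<close>. Since \<open>R\<close> has order \<open>2(n - 1)\<close>, it consists of the nonzero
  elements of \<open>F \<union> E\<close>. If \<open>B u w = 1\<close>, the neighbours of \<open>Ru\<close> are the \<open>R(w + tu)\<close>, and two of
  them are adjacent iff their parameters differ by an element of \<open>R\<close>; as the field is \<open>F \<oplus> E\<close>,
  this is the grid. The distance of \<open>Ru\<close> and \<open>Rv\<close> is read off from \<open>\<beta> = B u v\<close>: for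
  \<open>Ru \<noteq> Rv\<close> it is 1, 2 or 3 according to \<open>\<beta> \<in> R\<close>, \<open>\<beta> \<notin> R \<union> {0}\<close> or \<open>\<beta> = 0\<close>.
  For \<open>\<beta> \<notin> R \<union> {0}\<close> the common neighbours are parametrized by \<open>R\<close>, with \<open>x\<close> and \<open>y\<close> adjacent iff
  \<open>(x - y) / \<beta> \<in> R\<close>. This holds iff \<open>y / x\<close> is \<open>s\<close> or \<open>1 / s\<close> for
  \<open>s = (\<sigma> \<beta> - \<beta>) / (\<sigma> \<beta> + \<beta>)\<close>, so every \<open>\<mu>\<close>-graph is in fact a union of cycles whose length is the
  order of \<open>s\<close>.
\<close>

section \<open>Graphs given by a parametrization of the vertices\<close>

lemma gdist_eqI:
  assumes "(adj G ^^ k) x y" and "\<And>j. j < k \<Longrightarrow> \<not> (adj G ^^ j) x y"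
  shows "gdist G x y = enat k"
  unfolding gdist_def
proof (rule antisym)
  show "(INF j\<in>{j. (adj G ^^ j) x y}. enat j) \<le> enat k"
    using assms(1) by (intro INF_lower) simp
  show "enat k \<le> (INF j\<in>{j. (adj G ^^ j) x y}. enat j)"
    using assms(2) by (intro INF_greatest) (auto simp: not_less[symmetric])
qed

lemma rtranclp_adj_if_gdist_finite:
  assumes "gdist G x y \<noteq> \<infinity>"
  shows "(adj G)\<^sup>*\<^sup>* x y"
proof -
  \<comment> \<open>The infimum over the empty set is \<open>\<infinity>\<close> in
    \<open>enat\<close>, so a finite distance yields a walk.\<close>
  have "{k. (adj G ^^ k) x y} \<noteq> {}"
    using assms by (auto simp: gdist_def top_enat_def[symmetric])
  then show ?thesis
    using relpowp_imp_rtranclp by fast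
qed

text \<open>Both graphs are indexed by one set \<open>A\<close>, and the isomorphism is
  \<open>g\<close> after the inverse of \<open>f\<close>. Below, \<open>A\<close> is the field for
  the local grids and an interval of exponents for the cycles.\<close>

lemma graph_isoI_param:
  assumes f: "bij_betw f A (verts G)" and g: "bij_betw g A (verts H)"
    and eq: "\<And>a b. a \<in> A \<Longrightarrow> b \<in> A \<Longrightarrow> adj G (f a) (f b) \<longleftrightarrow> adj H (g a) (g b)"
  shows "graph_iso G H"
proof -
  have "bij_betw (g \<circ> the_inv_into A f) (verts G) (verts H)"
    using bij_betw_the_inv_into[OF f] g by (rule bij_betw_trans)
  moreover have "adj G x y \<longleftrightarrow> adj H ((g \<circ> the_inv_into A f) x) ((g \<circ> the_inv_into A f) y)"
    if "x \<in> verts G" "y \<in> verts G" for x y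
  proof -
    have "x \<in> f ` A" "y \<in> f ` A"
      using that bij_betw_imp_surj_on[OF f] by simp_all
    then obtain a b where ab: "a \<in> A" "b \<in> A" "x = f a" "y = f b"
      by (elim imageE)
    then show ?thesis
      unfolding ab(3,4) comp_def
      using eq[OF ab(1,2)] ab(1,2)[THEN the_inv_into_f_f[OF bij_betw_imp_inj_on[OF f]]] by simp
  qed
  ultimately show ?thesis
    by (auto simp: graph_iso_def)
qed

text \<open>The components of a Cayley graph of connection set \<open>{s, inverse s}\<close> are the cosets of the
  group generated by \<open>s\<close>.\<close>

lemma union_of_cycles_cayley:
  fixes s :: "'k::field" and f :: "'k \<Rightarrow> 'v"
  assumes fin: "finite A" and nz: "0 \<notin> A" and one: "1 \<in> A"
    and As: "\<And>x. x \<in> A \<Longrightarrow> x * s \<in> A" and ss: "s * s \<noteq> 1"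
    and f: "bij_betw f A (verts G)"
    and adj: "\<And>x y. x \<in> A \<Longrightarrow> y \<in> A \<Longrightarrow> adj G (f x) (f y) \<longleftrightarrow> y = x * s \<or> x = y * s"
    and adj_verts: "\<And>x y. adj G x y \<Longrightarrow> y \<in> verts G"
  shows "\<exists>l. union_of_cycles G l"
proof -
  have s0: "s \<noteq> 0"
    using As[OF one] nz by auto
  have pow: "x * s ^ i \<in> A" if "x \<in> A" for x i
  proof (induction i)
    case (Suc i)
    then show ?case
      using As[of "x * s ^ i"] by (simp add: mult_ac)
  qed (use that in simp)
  \<comment> \<open>The powers of \<open>s\<close> stay in the finite set \<open>A\<close>, so two
    of them coincide and \<open>s\<close> has finite order.\<close>
  have "\<not> inj (\<lambda>i. s ^ i)"
  proof
    assume "inj (\<lambda>i. s ^ i)"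
    moreover have "range (\<lambda>i. s ^ i) \<subseteq> A"
      using pow[OF one] by auto
    ultimately show False
      using fin finite_subset finite_imageD infinite_UNIV_nat by metis
  qed
  then obtain i j where "i \<noteq> j" "s ^ i = s ^ j"
    by (auto simp: inj_def)
  then obtain i j where ij: "i < j" "s ^ i = s ^ j"
    by (metis nat_neq_iff)
  have cancel: "s ^ (j - i) = 1" if "i < j" "s ^ i = s ^ j" for i j
  proof -
    have "s ^ i * s ^ (j - i) = s ^ i"
      using that unfolding power_add[symmetric] by simp
    then show ?thesis
      using s0 by simp
  qed
  \<comment> \<open>The order of \<open>s\<close>, which becomes the common length of the
    cycles.\<close>
  define d where "d = (LEAST d. d > 0 \<and> s ^ d = 1)"
  have "j - i > 0 \<and> s ^ (j - i) = 1"
    using ij cancel by simp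
  then have d: "d > 0 \<and> s ^ d = 1"
    unfolding d_def by (rule LeastI)
  have d_least: "\<not> (0 < m \<and> s ^ m = 1)" if "m < d" for m
    using that unfolding d_def by (rule not_less_Least)
  \<comment> \<open>Order 1 or 2 would give \<open>s * s = 1\<close>.\<close>
  have d3: "d \<ge> 3"
  proof -
    have "d \<noteq> 1" "d \<noteq> 2"
      using d ss by (auto simp: power2_eq_square)
    then show ?thesis
      using d by linarith
  qed
  have s_mod: "s ^ (i mod d) = s ^ i" for i
  proof -
    have "s ^ i = s ^ (i mod d + d * (i div d))"
      by simp
    also have "\<dots> = s ^ (i mod d)"
      unfolding power_add power_mult using d by simp
    finally show ?thesis by simp
  qed
  have s_inj: "i = j" if ij: "i < d" "j < d" "s ^ i = s ^ j" for i j
  proof (rule ccontr)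
    assume "i \<noteq> j"
    then consider "0 < j - i" "j - i < d" "s ^ (j - i) = 1" | "0 < i - j" "i - j < d" "s ^ (i - j) = 1"
      using cancel[of i j] cancel[of j i] ij \<open>i \<noteq> j\<close> by (cases "i < j") auto
    then show False
      using d_least by cases blast+
  qed
  have comp: "{y \<in> verts G. (adj G)\<^sup>*\<^sup>* (f x) y} = (\<lambda>i. f (x * s ^ i)) ` {..<d}" (is "?C = ?I")
    if x: "x \<in> A" for x
  proof
    have "(adj G)\<^sup>*\<^sup>* (f x) (f (x * s ^ i))" for i
    proof (induction i)
      case (Suc i)
      have "adj G (f (x * s ^ i)) (f (x * s ^ Suc i))"
        using adj[OF pow[OF x, of i] pow[OF x, of "Suc i"]] by (simp add: mult_ac)
      with Suc show ?case by (rule rtranclp.rtrancl_into_rtrancl)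
    qed simp
    then show "?I \<subseteq> ?C"
      using f pow[OF x] by (auto simp: bij_betw_def)
    have "\<exists>i. y = f (x * s ^ i)" if "(adj G)\<^sup>*\<^sup>* (f x) y" for y
      using that
    proof (induction rule: rtranclp_induct)
      case base
      show ?case by (rule exI[of _ 0]) simp
    next
      case (step y z)
      then obtain i where i: "y = f (x * s ^ i)" by blast
      obtain z' where z': "z' \<in> A" "z = f z'"
        using adj_verts[OF step(2)] f by (auto simp: bij_betw_def)
      then consider "z' = x * s ^ i * s" | "x * s ^ i = z' * s"
        using step(2) adj[OF pow[OF x] z'(1)] unfolding i by auto
      then show ?case
      proof cases
        case 1
        then show ?thesis
          using z' by (intro exI[of _ "Suc i"]) (simp add: mult_ac)
      next
        case 2
        \<comment> \<open>A backward step divides by \<open>s\<close>, which is the same as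
          multiplying by \<open>s ^ (d - 1)\<close>.\<close>
        have "x * s ^ (i + (d - 1)) = x * s ^ i * s ^ (d - 1)"
          by (simp add: power_add)
        also have "\<dots> = z' * s ^ Suc (d - 1)"
          by (simp add: 2 mult_ac)
        also have "\<dots> = z'"
          using d by simp
        finally show ?thesis
          using z' by metis
      qed
    qed
    then show "?C \<subseteq> ?I"
    proof (safe)
      fix y
      assume "\<And>y. (adj G)\<^sup>*\<^sup>* (f x) y \<Longrightarrow> \<exists>i. y = f (x * s ^ i)" "(adj G)\<^sup>*\<^sup>* (f x) y"
      then obtain i where "y = f (x * s ^ i)" by blast
      then show "y \<in> ?I"
        using d s_mod[of i] by (intro image_eqI[of _ _ "i mod d"]) auto
    qed
  qed
  have "graph_iso (induced G C) (cycle_graph d)" if C: "C \<in> components G" for C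
  proof -
    obtain z where "z \<in> verts G" and Cz: "C = {y \<in> verts G. (adj G)\<^sup>*\<^sup>* z y}"
      using C by (auto simp: components_def)
    then have "z \<in> f ` A"
      using bij_betw_imp_surj_on[OF f] by simp
    then obtain x where x: "x \<in> A" "z = f x"
      by (elim imageE)
    have Cx: "C = (\<lambda>i. f (x * s ^ i)) ` {..<d}"
      unfolding Cz x(2) using x(1) by (rule comp)
    have x0: "x \<noteq> 0"
      using x(1) nz by auto
    have fx: "f (x * s ^ i) = f (x * s ^ j) \<longleftrightarrow> s ^ i = s ^ j" for i j
      using f pow[OF x(1)] x0 by (auto simp: bij_betw_def inj_on_eq_iff)
    have sub: "C \<subseteq> verts G"
      using f pow[OF x(1)] by (auto simp: Cx bij_betw_def)
    show ?thesis
    proof (rule graph_isoI_param)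
      show "bij_betw (\<lambda>i. f (x * s ^ i)) {..<d} (verts (induced G C))"
        using s_inj sub by (auto simp: bij_betw_def inj_on_def fx induced_def Cx)
      show "bij_betw (\<lambda>i. i) {..<d} (verts (cycle_graph d))"
        by (simp add: cycle_graph_def bij_betw_def)
      fix i j
      assume ij: "i \<in> {..<d}" "j \<in> {..<d}"
      \<comment> \<open>The wrap-around of the cycle at \<open>d\<close> is the relation
        \<open>s ^ d = 1\<close>.\<close>
      have step: "x * s ^ a = x * s ^ b * s \<longleftrightarrow> a = (b + 1) mod d" if "a < d" for a b
      proof -
        have "x * s ^ a = x * s ^ b * s \<longleftrightarrow> s ^ a = s ^ (b + 1)"
          using x0 by (simp add: mult_ac)
        also have "\<dots> \<longleftrightarrow> s ^ a = s ^ ((b + 1) mod d)"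
          by (simp only: s_mod)
        also have "\<dots> \<longleftrightarrow> a = (b + 1) mod d"
          using s_inj[of a "(b + 1) mod d"] that d by auto
        finally show ?thesis .
      qed
      show "adj (induced G C) (f (x * s ^ i)) (f (x * s ^ j)) \<longleftrightarrow> adj (cycle_graph d) i j"
        using ij adj[OF pow[OF x(1)] pow[OF x(1)]] step[of i j] step[of j i]
        by (auto simp: induced_def cycle_graph_def Cx)
    qed
  qed
  then show ?thesis
    using d3 by (auto simp: union_of_cycles_def)
qed

section \<open>The subgroup \<open>R\<close>\<close>

lemma group_mult_group: "group (mult_group :: 'k::field monoid)"
proof (rule groupI)
  fix x :: 'k
  assume "x \<in> carrier mult_group"
  then show "\<exists>y\<in>carrier mult_group. y \<otimes>\<^bsub>mult_group\<^esub> x = \<one>\<^bsub>mult_group\<^esub>"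
    by (intro bexI[of _ "inverse x"]) (auto simp: mult_group_def)
qed (auto simp: mult_group_def)

lemma
  fixes H :: "'k::field set"
  assumes "subgroup H mult_group"
  shows subgroup_mult_group_one: "1 \<in> H"
    and subgroup_mult_group_mult: "\<And>x y. x \<in> H \<Longrightarrow> y \<in> H \<Longrightarrow> x * y \<in> H"
    and subgroup_mult_group_inverse: "\<And>x. x \<in> H \<Longrightarrow> inverse x \<in> H"
    and subgroup_mult_group_nonzero: "\<And>x. x \<in> H \<Longrightarrow> x \<noteq> 0"
proof -
  interpret subgroup H mult_group by fact
  show "1 \<in> H" "\<And>x y. x \<in> H \<Longrightarrow> y \<in> H \<Longrightarrow> x * y \<in> H"
    using one_closed m_closed by (auto simp: mult_group_def)
  show nz: "x \<noteq> 0" if "x \<in> H" for x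
    using subset that by (auto simp: mult_group_def)
  show "inverse x \<in> H" if "x \<in> H" for x
  proof -
    have "inv\<^bsub>mult_group\<^esub> x = inverse x"
      using nz[OF that]
      by (intro group.inv_equality[OF group_mult_group]) (auto simp: mult_group_def)
    then show ?thesis
      using subgroup.m_inv_closed[OF assms that] by simp
  qed
qed

text \<open>Lagrange's theorem for an element of the finite group \<open>H\<close>. It is applied to
  \<open>R\<close> and to the whole multiplicative group.\<close>

lemma subgroup_mult_group_power_card:
  fixes x :: "'k::field"
  assumes "subgroup H mult_group" "x \<in> H"
  shows "x ^ card H = 1"
proof -
  define G where "G = (mult_group\<lparr>carrier := H\<rparr> :: 'k monoid)"
  interpret G: group G
    unfolding G_def using assms(1) group_mult_group by (rule subgroup.subgroup_is_group)
  have "x [^]\<^bsub>G\<^esub> (m::nat) = x ^ m" for m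
    by (induction m) (auto simp: G_def mult_group_def nat_pow_def mult.commute)
  then show ?thesis
    using G.pow_order_eq_1[of x] assms(2) by (auto simp: G_def mult_group_def Coset.order_def)
qed

section \<open>The order of \<open>R\<close> and the automorphism \<open>frob\<close>\<close>

locale quadratic_subgroup =
  fixes n p k :: nat and R :: "'k::field set"
  assumes prime_p: "prime p" and odd_p: "odd p" and k_pos: "k \<ge> 1" and n_def: "n = p ^ k"
    and card_UNIV: "card (UNIV :: 'k set) = n\<^sup>2"
    and subgroup_R: "subgroup R mult_group"
    and index_R: "card (rcosets\<^bsub>mult_group\<^esub> R) = (n + 1) div 2"
begin

lemmas one_R = subgroup_mult_group_one[OF subgroup_R]
  and mult_R = subgroup_mult_group_mult[OF subgroup_R]
  and inverse_R = subgroup_mult_group_inverse[OF subgroup_R]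
  and nonzero_R = subgroup_mult_group_nonzero[OF subgroup_R]

lemma divide_R: "x \<in> R \<Longrightarrow> y \<in> R \<Longrightarrow> x / y \<in> R"
  by (simp add: divide_inverse mult_R inverse_R)

lemma mult_R_iff: "x \<in> R \<Longrightarrow> x * y \<in> R \<longleftrightarrow> y \<in> R"
  using divide_R[of "x * y" x] mult_R[of x y] nonzero_R[of x] by auto

lemma odd_n: "odd n"
  using odd_p by (simp add: n_def)

lemma n_ge_3: "n \<ge> 3"
proof -
  have "p \<ge> 3"
    using prime_ge_2_nat[OF prime_p] odd_p by (cases "p = 2") auto
  also have "p \<le> n"
    unfolding n_def using k_pos \<open>p \<ge> 3\<close> by (intro self_le_power) auto
  finally show ?thesis .
qed

lemma finite_UNIV_K: "finite (UNIV :: 'k set)"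
  using card_UNIV n_ge_3 by (intro card_ge_0_finite) auto

lemma finite_K [simp]: "finite (A :: 'k set)"
  using finite_subset[OF subset_UNIV finite_UNIV_K] .

lemma card_nonzero_K: "card (UNIV - {0 :: 'k}) = n\<^sup>2 - 1"
  using card_UNIV by (simp add: card_Diff_singleton)

lemma nsq_minus_1: "n\<^sup>2 - 1 = (n + 1) * (n - 1)"
  using n_ge_3 by (cases n) (auto simp: power2_eq_square)

text \<open>Lagrange's theorem divides \<open>n\<^sup>2 - 1 = (n + 1) * (n - 1)\<close> by the
  index. Writing \<open>n = 2 * m + 1\<close> makes the halving exact.\<close>

lemma card_R: "card R = 2 * (n - 1)"
proof -
  have "(n + 1) div 2 * card R = (n + 1) * (n - 1)"
    unfolding nsq_minus_1[symmetric]
    using group.lagrange[OF group_mult_group subgroup_R] index_R card_nonzero_K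
    by (simp add: Coset.order_def mult_group_def)
  moreover obtain m where m: "n = 2 * m + 1"
    using odd_n by (elim oddE)
  ultimately have "(m + 1) * card R = (m + 1) * (4 * m)"
    by simp
  then have "card R = 4 * m"
    by (simp only: mult_cancel1) simp
  then show ?thesis
    using m by simp
qed

lemma CHAR_K: "CHAR('k) = p"
proof -
  have "prime CHAR('k)"
    using finite_imp_CHAR_pos[OF finite_UNIV_K] by (rule prime_CHAR_semidom)
  moreover have "CHAR('k) dvd p ^ (k * 2)"
    using CHAR_dvd_CARD[where 'a = 'k] by (simp add: card_UNIV n_def power_mult)
  ultimately show ?thesis
    using prime_p by (metis prime_dvd_power primes_dvd_imp_eq)
qed

lemma two_nonzero: "(2 :: 'k) \<noteq> 0"
proof -
  have "\<not> CHAR('k) dvd 2"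
    using CHAR_K prime_p odd_p by (metis primes_dvd_imp_eq two_is_prime_nat dvd_refl)
  then have "(of_nat 2 :: 'k) \<noteq> 0"
    unfolding of_nat_eq_0_iff_char_dvd .
  then show ?thesis by simp
qed

text \<open>The nontrivial automorphism over the subfield with \<open>n\<close> elements.\<close>

definition frob :: "'k \<Rightarrow> 'k" where
  "frob x = x ^ n"

lemma frob_add: "frob (x + y) = frob x + frob y"
  unfolding frob_def by (rule freshmans_dream') (simp_all add: CHAR_K prime_p n_def)

lemma frob_mult: "frob (x * y) = frob x * frob y"
  by (simp add: frob_def power_mult_distrib)

lemma frob_minus: "frob (- x) = - frob x"
  using odd_n by (simp add: frob_def)

lemma frob_diff: "frob (x - y) = frob x - frob y"
  using frob_add[of x "- y"] by (simp add: frob_minus)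

lemma frob_zero [simp]: "frob 0 = 0"
  using n_ge_3 by (simp add: frob_def)

lemma frob_one [simp]: "frob 1 = 1"
  by (simp add: frob_def)

lemma frob_divide: "frob (x / y) = frob x / frob y"
  by (simp add: frob_def power_divide)

text \<open>The multiplicative group has order \<open>n\<^sup>2 - 1\<close>, so raising to the power
  \<open>n * n\<close> is the identity.\<close>

lemma frob_frob [simp]: "frob (frob x) = x"
proof (cases "x = 0")
  case False
  have "subgroup (UNIV - {0 :: 'k}) mult_group"
    using group.subgroup_self[OF group_mult_group] by (simp add: mult_group_def)
  with False have "x ^ (n\<^sup>2 - 1) = 1"
    using subgroup_mult_group_power_card[of "UNIV - {0}" x] by (simp add: card_nonzero_K)
  then have "x ^ Suc (n\<^sup>2 - 1) = x"
    by simp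
  also have "Suc (n\<^sup>2 - 1) = n * n"
    using n_ge_3 by (simp add: power2_eq_square)
  finally show ?thesis
    by (simp add: frob_def power_mult)
qed simp

lemma eq_minus_self_iff: "x = - x \<longleftrightarrow> x = (0 :: 'k)"
proof
  assume "x = - x"
  then have "2 * x = 0"
    by (metis add.right_inverse mult_2)
  then show "x = 0"
    using two_nonzero by simp
qed simp

section \<open>The eigenspaces of \<open>frob\<close> and their union\<close>

abbreviation fixed :: "'k set" where "fixed \<equiv> {x. frob x = x}"
abbreviation antifixed :: "'k set" where "antifixed \<equiv> {x. frob x = - x}"

text \<open>These are the roots of the polynomial \<open>X ^ n - c * X\<close>, whose leading
  coefficient is 1.\<close>

lemma card_frob_eigenvectors_le: "card {x. frob x = c * x} \<le> n"
proof -
  define P where "P = Polynomial.monom 1 n - [:0, c:]"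
  have "Polynomial.coeff P n = 1"
    using n_ge_3 by (auto simp: P_def coeff_pCons split: nat.splits)
  then have "P \<noteq> 0" by auto
  moreover have "degree P \<le> n"
    unfolding P_def using n_ge_3
    by (intro degree_diff_le degree_monom_le order.trans[OF degree_pCons_le]) auto
  moreover have "{x. poly P x = 0} = {x. frob x = c * x}"
    by (simp add: P_def poly_monom frob_def mult.commute)
  ultimately show ?thesis
    using card_poly_roots_bound[of P] by simp
qed

text \<open>The field is the direct sum of the two eigenspaces. The coordinates are twice the
  projections, and 2 is invertible. They later become the row and column of the local grid.\<close>

lemma bij_betw_coords: "bij_betw (\<lambda>x. (x + frob x, x - frob x)) UNIV (fixed \<times> antifixed)"
proof -
  have "inj (\<lambda>x. (x + frob x, x - frob x))"
  proof (rule injI)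
    fix x y
    assume "(x + frob x, x - frob x) = (y + frob y, y - frob y)"
    then have "(x + frob x) + (x - frob x) = (y + frob y) + (y - frob y)"
      by (metis prod.inject)
    then have "2 * x = 2 * y" by simp
    then show "x = y"
      using two_nonzero by simp
  qed
  moreover have "(\<lambda>x. (x + frob x, x - frob x)) ` UNIV \<subseteq> fixed \<times> antifixed"
    by (auto simp: frob_add frob_diff)
  moreover have "(a, b) \<in> range (\<lambda>x. (x + frob x, x - frob x))"
    if "frob a = a" "frob b = - b" for a b
  proof -
    have 2: "frob 2 = 2"
      using frob_add[of 1 1] by simp
    have "(4 :: 'k) = 2 * 2" by simp
    then have "(4 :: 'k) \<noteq> 0"
      using two_nonzero by (metis mult_eq_0_iff)
    \<comment> \<open>The preimage is \<open>(a + b) / 2\<close>, which \<open>frob\<close> sends to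
      \<open>(a - b) / 2\<close>.\<close>
    then have "(a, b) = ((a + b) / 2 + frob ((a + b) / 2), (a + b) / 2 - frob ((a + b) / 2))"
      using that two_nonzero by (simp add: frob_add frob_divide 2 field_simps)
    then show ?thesis by blast
  qed
  ultimately show ?thesis
    by (auto simp: bij_betw_def)
qed

text \<open>Each eigenspace has at most \<open>n\<close> elements, and by the decomposition the
  product of the two orders is \<open>n * n\<close>.\<close>

lemma card_fixed: "card fixed = n" and card_antifixed: "card antifixed = n"
proof -
  have le: "card fixed \<le> n" "card antifixed \<le> n"
    using card_frob_eigenvectors_le[of 1] card_frob_eigenvectors_le[of "- 1"] by simp_all
  have "card fixed * card antifixed = n * n"
    using bij_betw_same_card[OF bij_betw_coords] card_UNIV
    by (simp add: card_cartesian_product power2_eq_square)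
  moreover have "card fixed * card antifixed \<le> card fixed * n"
      "card fixed * card antifixed \<le> n * card antifixed"
    using le by simp_all
  ultimately show "card fixed = n" "card antifixed = n"
    using le n_ge_3 by (auto intro: antisym)
qed

text \<open>Since \<open>R\<close> has order \<open>2 * (n - 1)\<close>, each \<open>x\<close> in it
  satisfies \<open>x ^ (n - 1) = 1\<close> or \<open>x ^ (n - 1) = - 1\<close>, so it is an
  eigenvector. The eigenspaces meet only in 0, so their nonzero elements number
  \<open>2 * (n - 1)\<close> as well, and the inclusion is an equality.\<close>

lemma mem_R_iff: "x \<in> R \<longleftrightarrow> x \<noteq> 0 \<and> (frob x = x \<or> frob x = - x)"
proof -
  have "x \<in> fixed \<union> antifixed - {0}" if "x \<in> R" for x
  proof -
    have "x ^ card R = 1"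
      using subgroup_R that by (rule subgroup_mult_group_power_card)
    then have "(x ^ (n - 1))\<^sup>2 = 1"
      by (simp add: card_R mult.commute flip: power_mult)
    then have "x ^ (n - 1) = 1 \<or> x ^ (n - 1) = - 1"
      by (simp add: power2_eq_1_iff)
    moreover have "frob x = x * x ^ (n - 1)"
      unfolding frob_def using n_ge_3 by (metis Suc_diff_1 gr0I not_numeral_le_zero power_Suc)
    ultimately show ?thesis
      using nonzero_R[OF that] by auto
  qed
  then have sub: "R \<subseteq> fixed \<union> antifixed - {0}" by blast
  have "x = 0" if "frob x = x" "frob x = - x" for x
    using that eq_minus_self_iff[of x] by metis
  moreover have "0 \<in> fixed \<inter> antifixed"
    by simp
  ultimately have "fixed \<inter> antifixed = {0}"
    by blast
  then have "card (fixed \<union> antifixed) + 1 = n + n"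
    using card_Un_Int[of fixed antifixed] by (simp add: card_fixed card_antifixed)
  then have "card (fixed \<union> antifixed - {0}) = card R"
    by (subst card_Diff_singleton) (auto simp: card_R)
  with sub have "R = fixed \<union> antifixed - {0}"
    by (intro card_subset_eq) auto
  then show ?thesis by blast
qed

lemma zero_notin_R [simp]: "0 \<notin> R"
  by (simp add: mem_R_iff)

lemma frob_R: "x \<in> R \<Longrightarrow> frob x = x \<or> frob x = - x"
  by (simp add: mem_R_iff)

text \<open>Together with the antisymmetry of \<open>B\<close>, this makes adjacency
  symmetric.\<close>

lemma minus_R_iff [simp]: "- x \<in> R \<longleftrightarrow> x \<in> R"
  by (simp add: mem_R_iff frob_minus) (metis minus_minus)

text \<open>If \<open>1 - t = b * x\<close> with \<open>x \<in> R\<close>, then applying \<open>frob\<close> gives \<open>1 + t = \<plusminus> frob b * x\<close>,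
  and the quotient of the two equations determines \<open>t\<close> up to inversion.\<close>

definition cyc :: "'k \<Rightarrow> 'k" where
  "cyc b = (frob b - b) / (frob b + b)"

section \<open>Differences of elements of \<open>R\<close> that lie in \<open>R\<close> after
  division by \<open>b\<close>\<close>

context
  fixes b :: 'k
  assumes b: "b \<noteq> 0" "b \<notin> R"
begin

lemma frob_sum_diff_nonzero: "frob b + b \<noteq> 0" "frob b - b \<noteq> 0"
proof -
  have "frob b \<noteq> - b" "frob b \<noteq> b"
    using b by (auto simp: mem_R_iff)
  then show "frob b + b \<noteq> 0" "frob b - b \<noteq> 0"
    by (simp_all add: add_eq_0_iff2)
qed

text \<open>Since \<open>frob\<close> interchanges \<open>b\<close> and \<open>frob b\<close>, it
  negates the numerator and fixes the denominator.\<close>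

lemma frob_cyc: "frob (cyc b) = - cyc b"
  by (simp add: cyc_def frob_divide frob_add frob_diff add.commute minus_divide_left)

lemma cyc_nonzero: "cyc b \<noteq> 0"
  using frob_sum_diff_nonzero by (simp add: cyc_def)

lemma cyc_R: "cyc b \<in> R"
  using cyc_nonzero frob_cyc by (simp add: mem_R_iff)

text \<open>Both 1 and -1 are fixed by \<open>frob\<close>, whereas \<open>cyc b\<close> is negated.
  This rules out cycles of length below 3.\<close>

lemma cyc_square: "cyc b * cyc b \<noteq> 1"
proof
  assume "cyc b * cyc b = 1"
  then have "cyc b = 1 \<or> cyc b = - 1"
    by (simp add: square_eq_1_iff)
  then show False
    using frob_cyc eq_minus_self_iff[of 1] by (auto simp: frob_minus)
qed

lemma one_minus_divide_R_iff:
  assumes t: "t \<in> R"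
  shows "(1 - t) / b \<in> R \<longleftrightarrow> t = cyc b \<or> t = inverse (cyc b)"
proof
  note nz = frob_sum_diff_nonzero
  define x where "x = (1 - t) / b"
  have bx: "b * x = 1 - t" and tx: "t = 1 - b * x"
    using b by (simp_all add: x_def)
  assume "(1 - t) / b \<in> R"
  then have x: "x \<in> R" by (simp add: x_def)
  have ct: "frob t = - t"
  \<comment> \<open>If \<open>t\<close> were fixed, then \<open>1 - t\<close> would be a nonzero
    fixed element, hence in \<open>R\<close>, and so would be
    \<open>b = (1 - t) / x\<close>.\<close>
  proof (rule ccontr)
    assume "frob t \<noteq> - t"
    then have "frob t = t"
      using frob_R[OF t] by auto
    then have "1 - t \<in> R"
      using x b by (auto simp: mem_R_iff frob_diff x_def)
    then have "(1 - t) / x \<in> R"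
      using x by (rule divide_R)
    then show False
      using b nonzero_R[OF x] by (simp add: tx)
  qed
  have eq: "1 + t = frob b * frob x"
    using arg_cong[OF tx, of frob] ct by (simp add: frob_diff frob_mult algebra_simps)
  show "t = cyc b \<or> t = inverse (cyc b)"
    using frob_R[OF x]
  proof
    assume "frob x = x"
    with eq have fx: "frob b * x = 1 + t" by simp
    \<comment> \<open>The sum of \<open>frob b * x = 1 + t\<close> and \<open>b * x = 1 - t\<close>
      is 2 and their difference is \<open>2 * t\<close>.\<close>
    have "t * (frob b * x + b * x) = frob b * x - b * x"
      unfolding fx bx by (simp add: algebra_simps)
    then have "x * (t * (frob b + b)) = x * (frob b - b)"
      by (simp add: algebra_simps)
    then show ?thesis
      using nz nonzero_R[OF x] by (simp add: cyc_def eq_divide_eq)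
  next
    assume "frob x = - x"
    with eq have fx: "frob b * x = - (1 + t)" by simp
    \<comment> \<open>The sign of \<open>frob b * x\<close> has changed, so sum and difference
      exchange roles and the inverse of \<open>cyc b\<close> appears.\<close>
    have "t * (frob b * x - b * x) = frob b * x + b * x"
      unfolding fx bx by (simp add: algebra_simps)
    then have "x * (t * (frob b - b)) = x * (frob b + b)"
      by (simp add: algebra_simps)
    then show ?thesis
      using nz nonzero_R[OF x] by (simp add: cyc_def eq_divide_eq)
  qed
next
  note nz = frob_sum_diff_nonzero
  have 2: "frob 2 = 2"
    using frob_add[of 1 1] by simp
  assume "t = cyc b \<or> t = inverse (cyc b)"
  then show "(1 - t) / b \<in> R"
  proof
    assume "t = cyc b"
    \<comment> \<open>The quotient by \<open>b\<close> is \<open>2 / (frob b + b)\<close>, which is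
      fixed by \<open>frob\<close>.\<close>
    then have "1 - t = b * (2 / (frob b + b))"
      using nz by (simp add: cyc_def diff_divide_eq_iff)
    then have "(1 - t) / b = 2 / (frob b + b)"
      using b by simp
    then show ?thesis
      using nz two_nonzero by (simp add: mem_R_iff frob_divide frob_add 2 add.commute)
  next
    assume "t = inverse (cyc b)"
    \<comment> \<open>Here the quotient is \<open>- 2 / (frob b - b)\<close>, which
      \<open>frob\<close> negates.\<close>
    then have "1 - t = b * (- 2 / (frob b - b))"
      using nz by (simp add: cyc_def diff_divide_eq_iff)
    then have "(1 - t) / b = - 2 / (frob b - b)"
      using b by simp
    moreover have "frob (frob b - b) = - (frob b - b)"
      by (simp add: frob_diff)
    then have "frob (- 2 / (frob b - b)) = - (- 2 / (frob b - b))"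
      by (simp only: frob_divide frob_minus 2 divide_minus_right)
    ultimately show ?thesis
      using nz two_nonzero by (simp add: mem_R_iff)
  qed
qed

text \<open>Dividing by \<open>x \<in> R\<close> reduces this to \<open>t = y / x\<close>. An
  additive condition thereby becomes adjacency in a multiplicative Cayley graph on \<open>R\<close>,
  the form required by \<open>union_of_cycles_cayley\<close>.\<close>

lemma diff_divide_R_iff:
  assumes x: "x \<in> R" and y: "y \<in> R"
  shows "(x - y) / b \<in> R \<longleftrightarrow> y = x * cyc b \<or> x = y * cyc b"
proof -
  have eq: "(x - y) / b = x * ((1 - y / x) / b)"
    using nonzero_R[OF x] by (simp add: right_diff_distrib)
  have "(x - y) / b \<in> R \<longleftrightarrow> y / x = cyc b \<or> y / x = inverse (cyc b)"
    unfolding eq mult_R_iff[OF x] using divide_R[OF y x] by (rule one_minus_divide_R_iff)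
  then show ?thesis
    using nonzero_R[OF x] cyc_nonzero by (auto simp: field_simps)
qed

end

end

section \<open>The graph of a symplectic plane\<close>

locale symplectic_plane = quadratic_subgroup n p k R + vector_space scale
  for n p k :: nat and R :: "'k::field set"
    and scale :: "'k \<Rightarrow> 'v::ab_group_add \<Rightarrow> 'v" (infixr \<open>*s\<close> 75) +
  fixes B :: "'v \<Rightarrow> 'v \<Rightarrow> 'k"
  assumes dim_V: "dim UNIV = 2" and symplectic: "symplectic_form scale B"
begin

section \<open>Linear algebra of the symplectic plane\<close>

abbreviation \<Gamma> :: "'v set graph" where "\<Gamma> \<equiv> Gamma scale B R"
abbreviation orb :: "'v \<Rightarrow> 'v set" where "orb \<equiv> orbit scale R"

lemma B_hom: "module_hom scale (*) (\<lambda>v. B u v)" "module_hom scale (*) (\<lambda>u. B u v)"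
  using symplectic by (auto simp: symplectic_form_def module_hom_iff_linear)

lemma B_linear [simp]:
  shows "B (u + v) w = B u w + B v w" "B u (v + w) = B u v + B u w"
    and "B (a *s u) w = a * B u w" "B u (a *s w) = a * B u w"
    and "B 0 w = 0" "B u 0 = 0" "B (- u) w = - B u w" "B u (- w) = - B u w"
    and "B (u - v) w = B u w - B v w" "B u (v - w) = B u v - B u w"
  using module_hom.add[OF B_hom(1)] module_hom.add[OF B_hom(2)]
    module_hom.scale[OF B_hom(1)] module_hom.scale[OF B_hom(2)]
    module_hom.zero[OF B_hom(1)] module_hom.zero[OF B_hom(2)]
    module_hom.neg[OF B_hom(1)] module_hom.neg[OF B_hom(2)]
    module_hom.diff[OF B_hom(1)] module_hom.diff[OF B_hom(2)] by auto

lemma B_self [simp]: "B u u = 0"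
  using symplectic by (simp add: symplectic_form_def)

lemma B_swap: "B v u = - B u v"
proof -
  have "B v u + B u v = 0"
    using B_self[of "u + v"] unfolding B_linear(1,2) by (simp add: add.commute)
  then show ?thesis
    by (simp add: eq_neg_iff_add_eq_0)
qed

lemma ex_dual:
  assumes "u \<noteq> 0"
  obtains v where "B u v = 1"
proof -
  obtain v where "B u v \<noteq> 0"
    using symplectic assms unfolding symplectic_form_def by blast
  then have "B u (inverse (B u v) *s v) = 1"
    by simp
  then show thesis by (rule that)
qed

text \<open>As \<open>B v v = 0\<close>, the condition \<open>B u v \<noteq> 0\<close> makes
  \<open>u\<close>, \<open>v\<close> independent, hence a basis. Pairing \<open>w\<close> with
  \<open>v\<close> and with \<open>u\<close> isolates the two coefficients.\<close>

lemma symplectic_expansion: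
  assumes uv: "B u v \<noteq> 0"
  shows "w = (B w v / B u v) *s u + (B u w / B u v) *s v"
proof -
  obtain Bs where Bs: "independent Bs" "span Bs = UNIV" "card Bs = 2"
    using basis_exists[of UNIV] dim_V by (metis top.extremum_uniqueI)
  \<comment> \<open>\<open>card\<close> is 0 on infinite sets, so a basis of cardinality 2 is
    finite.\<close>
  interpret finite_dimensional_vector_space scale Bs
    using Bs by unfold_locales (auto intro: card_ge_0_finite)
  have "u \<noteq> v" "v \<noteq> 0"
    using uv by auto
  moreover have "u \<notin> span {v}"
    using uv by (auto simp: span_singleton)
  ultimately have "independent {u, v}"
    by (simp add: independent_insert)
  then have "span {u, v} = UNIV"
    using card_eq_dim[of "{u, v}" UNIV] dim_V \<open>u \<noteq> v\<close> by auto
  then obtain a where "w - a *s u \<in> span {v}"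
    using span_breakdown_eq[of w u "{v}"] by blast
  then obtain b where "w - a *s u = b *s v"
    unfolding span_singleton by blast
  then have w: "w = a *s u + b *s v"
    by (simp add: diff_eq_eq add.commute)
  show ?thesis
    using uv by (simp add: w)
qed

text \<open>In a basis \<open>u\<close>, \<open>w\<close> with \<open>B u w = 1\<close>, the
  coefficient of \<open>v\<close> at \<open>w\<close> is \<open>B u v\<close>; thus each line is its
  own orthogonal complement.\<close>

lemma B_eq_0_iff:
  assumes "u \<noteq> 0"
  shows "B u v = 0 \<longleftrightarrow> (\<exists>a. v = a *s u)"
proof
  obtain w where w: "B u w = 1"
    using ex_dual assms by blast
  assume "B u v = 0"
  then have "v = B v w *s u"
    using symplectic_expansion[of u w v] w by simp
  then show "\<exists>a. v = a *s u" ..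
qed auto

lemma card_UNIV_V: "card (UNIV :: 'v set) = n ^ 4"
proof -
  have "\<exists>u. u \<noteq> (0 :: 'v)"
  proof (rule ccontr)
    assume "\<not> ?thesis"
    then have "(UNIV :: 'v set) = span {}" by auto
    then have "dim (UNIV :: 'v set) = 0"
      by (metis dim_span dim_eq_card_independent independent_empty card.empty)
    then show False
      using dim_V by simp
  qed
  then obtain u :: 'v where "u \<noteq> 0" by blast
  then obtain v where v: "B u v = 1"
    by (rule ex_dual)
  have "bij_betw (\<lambda>(a, b). a *s u + b *s v) UNIV UNIV"
    unfolding bij_betw_def
  proof
    show "inj (\<lambda>(a, b). a *s u + b *s v)"
    proof (rule injI, clarify)
      fix a b a' b'
      assume eq: "a *s u + b *s v = a' *s u + b' *s v"
      show "a = a' \<and> b = b'"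
        using arg_cong[OF eq, of "B u"] arg_cong[OF eq, of "\<lambda>w. B w v"] v by simp
    qed
    show "range (\<lambda>(a, b). a *s u + b *s v) = UNIV"
    proof (rule surjI)
      show "(case (B w v, B u w) of (a, b) \<Rightarrow> a *s u + b *s v) = w" for w
        using symplectic_expansion[of u v w] v by simp
    qed
  qed
  then have "card (UNIV :: 'v set) = card (UNIV :: ('k \<times> 'k) set)"
    by (simp add: bij_betw_same_card)
  also have "\<dots> = n ^ 4"
    by (simp add: card_UNIV card_cartesian_product flip: UNIV_Times_UNIV power_add)
  finally show ?thesis .
qed

lemma finite_V [simp]: "finite (S :: 'v set)"
proof (rule finite_subset[OF subset_UNIV])
  show "finite (UNIV :: 'v set)"
    using card_UNIV_V n_ge_3 by (intro card_ge_0_finite) simp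
qed

section \<open>Orbits of \<open>R\<close> and the number of vertices\<close>

lemma mem_orb: "u \<in> orb u"
  using one_R by (auto simp: orbit_def intro!: image_eqI[of _ _ 1])

lemma mem_orb_iff: "v \<in> orb u \<longleftrightarrow> (\<exists>a\<in>R. v = a *s u)"
  by (auto simp: orbit_def)

lemma orb_scale: "a \<in> R \<Longrightarrow> orb (a *s u) = orb u"
proof (safe; unfold mem_orb_iff)
  fix v b
  assume a: "a \<in> R"
  {
    assume "\<exists>b\<in>R. v = b *s a *s u"
    then show "\<exists>a\<in>R. v = a *s u"
      using mult_R a by auto
  next
    assume "\<exists>b\<in>R. v = b *s u"
    then obtain b where b: "b \<in> R" "v = b *s u" by blast
    then have "v = (b / a) *s a *s u"
      using nonzero_R[OF a] by simp
    then show "\<exists>b\<in>R. v = b *s a *s u"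
      using divide_R[OF b(1) a] by blast
  }
qed

lemma orb_eq_iff: "orb u = orb v \<longleftrightarrow> (\<exists>a\<in>R. v = a *s u)"
  using mem_orb[of v] orb_scale mem_orb_iff by metis

lemma orb_disjoint: "orb u \<inter> orb v = {}" if "orb u \<noteq> orb v"
proof (rule ccontr)
  assume "orb u \<inter> orb v \<noteq> {}"
  then obtain w where "w \<in> orb u" "w \<in> orb v" by blast
  then show False
    using that orb_scale by (metis mem_orb_iff)
qed

lemma card_orb: "u \<noteq> 0 \<Longrightarrow> card (orb u) = card R"
  unfolding orbit_def by (intro card_image inj_onI) auto

lemma zero_notin_orb: "u \<noteq> 0 \<Longrightarrow> 0 \<notin> orb u"
  using nonzero_R by (auto simp: mem_orb_iff)

lemma verts_Gamma: "verts \<Gamma> = orb ` (UNIV - {0})"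
  by (simp add: Gamma_def)

lemma adj_orb_iff: "u \<noteq> 0 \<Longrightarrow> v \<noteq> 0 \<Longrightarrow> adj \<Gamma> (orb u) (orb v) \<longleftrightarrow> B u v \<in> R"
  using symplectic subgroup_R by (rule adj_Gamma_orbit_iff)

lemma adj_Gamma_verts: "adj \<Gamma> X Y \<Longrightarrow> X \<in> verts \<Gamma> \<and> Y \<in> verts \<Gamma>"
  by (auto simp: Gamma_def)

lemma B_swap_R: "B u v \<in> R \<longleftrightarrow> B v u \<in> R"
  using B_swap[of u v] by simp

lemma simple_graph_Gamma: "simple_graph \<Gamma>"
  unfolding simple_graph_def
proof (intro conjI allI impI)
  show "finite (verts \<Gamma>)"
    by (simp add: verts_Gamma)
  show "X \<in> verts \<Gamma>" "Y \<in> verts \<Gamma>" if "adj \<Gamma> X Y" for X Y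
    using adj_Gamma_verts[OF that] by simp_all
  show "adj \<Gamma> Y X" if "adj \<Gamma> X Y" for X Y
    using that B_swap_R by (auto simp: Gamma_def)
  show "\<not> adj \<Gamma> X X" for X
  proof
    assume "adj \<Gamma> X X"
    moreover then obtain u where "u \<noteq> 0" "X = orb u"
      using adj_Gamma_verts verts_Gamma by blast
    ultimately show False
      by (simp add: adj_orb_iff)
  qed
qed

text \<open>\<open>R\<close> acts freely on nonzero vectors, so all orbits in \<open>S\<close> have
  size \<open>card R\<close>. This counts the vertices, and later the orbits on a single
  line.\<close>

lemma card_orb_partition:
  assumes "0 \<notin> S" and "\<And>u. u \<in> S \<Longrightarrow> orb u \<subseteq> S"
  shows "card R * card (orb ` S) = card S"
proof -
  have "\<Union> (orb ` S) = S"
    using assms(2) mem_orb by blast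
  moreover have "card R * card (orb ` S) = card (\<Union> (orb ` S))"
    using assms(1) orb_disjoint by (intro card_partition) (auto intro!: card_orb)
  ultimately show ?thesis by simp
qed

lemma half_n_times_card_R: "(n + 1) div 2 * card R = n\<^sup>2 - 1"
proof -
  obtain m where m: "n = 2 * m + 1"
    using odd_n by (elim oddE)
  have "(n + 1) div 2 * card R = (n + 1) * (n - 1)"
    unfolding card_R using m by simp
  then show ?thesis
    unfolding nsq_minus_1 .
qed

lemma card_verts: "card (verts \<Gamma>) = (n\<^sup>2 + 1) * ((n + 1) div 2)"
proof -
  have "card R * card (verts \<Gamma>) = n ^ 4 - 1"
    unfolding verts_Gamma using zero_notin_orb card_UNIV_V
    by (subst card_orb_partition) (auto simp: card_Diff_singleton)
  also have "\<dots> = (n\<^sup>2 + 1) * (n\<^sup>2 - 1)"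
  proof -
    have "n ^ 4 = n\<^sup>2 * n\<^sup>2"
      by (simp flip: power_add)
    then show ?thesis
      by (simp add: algebra_simps)
  qed
  also have "\<dots> = card R * ((n\<^sup>2 + 1) * ((n + 1) div 2))"
    unfolding half_n_times_card_R[symmetric] by (simp only: mult_ac)
  finally show ?thesis
    using card_R n_ge_3 by simp
qed

section \<open>Neighbourhoods and the local grid\<close>

lemma B_nonzero_args: "B u w \<noteq> 0 \<Longrightarrow> w \<noteq> 0" "B u w \<noteq> 0 \<Longrightarrow> u \<noteq> 0"
  by auto

text \<open>A neighbour \<open>orb v\<close> has exactly one representative pairing to 1 with
  \<open>u\<close>, obtained by dividing \<open>v\<close> by \<open>B u v \<in> R\<close>. The
  vectors that pair to 1 with \<open>u\<close> form the affine line through \<open>w\<close> in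
  direction \<open>u\<close>.\<close>

lemma bij_betw_nbhd:
  assumes w: "B u w = 1"
  shows "bij_betw (\<lambda>t. orb (w + t *s u)) UNIV (nbhd \<Gamma> (orb u))"
  unfolding bij_betw_def
proof
  have B1: "B u (w + t *s u) = 1" and nz: "w + t *s u \<noteq> 0" for t
    using w B_nonzero_args(1)[of u "w + t *s u"] by simp_all
  have u: "u \<noteq> 0"
    using B_nonzero_args(2)[of u w] w by simp
  show "inj (\<lambda>t. orb (w + t *s u))"
  proof (rule injI)
    fix t t'
    assume "orb (w + t *s u) = orb (w + t' *s u)"
    then obtain a where a: "w + t' *s u = a *s (w + t *s u)"
      by (auto simp: orb_eq_iff)
    have "a = 1"
      using arg_cong[OF a, of "B u"] B1 w by simp
    then show "t = t'"
      using arg_cong[OF a, of "\<lambda>x. B x w"] w by simp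
  qed
  show "range (\<lambda>t. orb (w + t *s u)) = nbhd \<Gamma> (orb u)"
  proof (intro equalityI subsetI)
    fix X
    assume "X \<in> nbhd \<Gamma> (orb u)"
    then have X: "X \<in> verts \<Gamma>" "adj \<Gamma> (orb u) X"
      by (simp_all add: nbhd_def)
    then obtain v where v: "v \<noteq> 0" "X = orb v"
      unfolding verts_Gamma by blast
    then have Buv: "B u v \<in> R"
      using u X adj_orb_iff by simp
    define v' where "v' = inverse (B u v) *s v"
    have v': "X = orb v'" "B u v' = 1"
      using v inverse_R[OF Buv] nonzero_R[OF Buv] orb_scale by (simp_all add: v'_def)
    have "v' = w + B v' w *s u"
      using symplectic_expansion[of u w v'] w v' by (simp add: add.commute)
    then have "X = orb (w + B v' w *s u)"
      unfolding v'(1) by (rule arg_cong)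
    then show "X \<in> range (\<lambda>t. orb (w + t *s u))"
      by blast
  next
    fix X
    assume "X \<in> range (\<lambda>t. orb (w + t *s u))"
    then obtain t where "X = orb (w + t *s u)" by blast
    moreover have "B u (w + t *s u) \<in> R"
      using B1 one_R by simp
    ultimately show "X \<in> nbhd \<Gamma> (orb u)"
      using u nz[of t] by (simp add: nbhd_def verts_Gamma adj_orb_iff)
  qed
qed

lemma card_nbhd: "u \<noteq> 0 \<Longrightarrow> card (nbhd \<Gamma> (orb u)) = n\<^sup>2"
  using ex_dual bij_betw_same_card[OF bij_betw_nbhd] card_UNIV by metis

text \<open>The neighbour with parameter \<open>t\<close> is sent to the numbered coordinates of
  \<open>t\<close> in the two eigenspaces. Neighbours are adjacent iff
  \<open>t - t' \<in> R\<close>, that is, iff \<open>t - t'\<close> is nonzero and one of its two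
  coordinates vanishes.\<close>

lemma locally_grid_Gamma: "locally_grid \<Gamma> n"
  unfolding locally_grid_def
proof
  fix X
  assume "X \<in> verts \<Gamma>"
  then obtain u where u: "u \<noteq> 0" "X = orb u"
    by (auto simp: verts_Gamma)
  obtain w where w: "B u w = 1"
    using ex_dual u by blast
  have nz: "w + t *s u \<noteq> 0" for t
    using w B_nonzero_args(1)[of u "w + t *s u"] by simp
  \<comment> \<open>Arbitrary numberings of the eigenspaces, both of which have \<open>n\<close>
    elements.\<close>
  obtain e e' where e: "bij_betw e fixed {1..n}" and e': "bij_betw e' antifixed {1..n}"
    using finite_same_card_bij[of fixed "{1..n}"] finite_same_card_bij[of antifixed "{1..n}"]
      card_fixed card_antifixed by auto
  have "bij_betw (map_prod e e' \<circ> (\<lambda>x. (x + frob x, x - frob x))) UNIV ({1..n} \<times> {1..n})"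
    using bij_betw_coords bij_betw_map_prod[OF e e'] by (rule bij_betw_trans)
  moreover define g where "g x = (e (x + frob x), e' (x - frob x))" for x
  ultimately have g: "bij_betw g UNIV ({1..n} \<times> {1..n})"
    by (simp add: comp_def g_def[abs_def])
  have mem: "x + frob x \<in> fixed" "x - frob x \<in> antifixed" for x
    by (simp_all add: frob_add frob_diff)
  have e_eq: "e (x + frob x) = e (y + frob y) \<longleftrightarrow> frob (x - y) = - (x - y)" for x y
    unfolding inj_on_eq_iff[OF bij_betw_imp_inj_on[OF e] mem(1) mem(1)]
    by (auto simp: frob_diff algebra_simps)
  have e'_eq: "e' (x - frob x) = e' (y - frob y) \<longleftrightarrow> frob (x - y) = x - y" for x y
    unfolding inj_on_eq_iff[OF bij_betw_imp_inj_on[OF e'] mem(2) mem(2)]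
    by (auto simp: frob_diff algebra_simps)
  \<comment> \<open>Both coordinates agree only for \<open>x = y\<close>, so the exclusive
    disjunction also excludes a zero difference.\<close>
  have g_R: "x - y \<in> R \<longleftrightarrow> (e (x + frob x) = e (y + frob y)) \<noteq> (e' (x - frob x) = e' (y - frob y))" for x y
    unfolding e_eq e'_eq mem_R_iff using eq_minus_self_iff[of "x - y"] by auto
  show "graph_iso (induced \<Gamma> (nbhd \<Gamma> X)) (grid_graph n)"
  proof (rule graph_isoI_param)
    show "bij_betw (\<lambda>t. orb (w + t *s u)) UNIV (verts (induced \<Gamma> (nbhd \<Gamma> X)))"
      using bij_betw_nbhd[OF w] by (auto simp: induced_def u nbhd_def Int_def conj_ac)
    show "bij_betw g UNIV (verts (grid_graph n))"
      using g by (simp add: grid_graph_def)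
    fix t t'
    have "orb (w + t *s u) \<in> nbhd \<Gamma> X" for t
      using bij_betw_nbhd[OF w] u by (auto simp: bij_betw_def)
    moreover have "B (w + t *s u) (w + t' *s u) = t - t'"
      using w B_swap[of w u] by simp
    ultimately have "adj (induced \<Gamma> (nbhd \<Gamma> X)) (orb (w + t *s u)) (orb (w + t' *s u)) \<longleftrightarrow> t - t' \<in> R"
      using nz by (simp add: induced_def adj_orb_iff)
    also have "\<dots> \<longleftrightarrow> adj (grid_graph n) (g t) (g t')"
    proof -
      have "g t \<in> {1..n} \<times> {1..n}" for t
        using g by (auto simp: bij_betw_def)
      then show ?thesis
        using g_R[of t t'] by (auto simp: grid_graph_def g_def)
    qed
    finally show "adj (induced \<Gamma> (nbhd \<Gamma> X)) (orb (w + t *s u)) (orb (w + t' *s u)) \<longleftrightarrow>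
        adj (grid_graph n) (g t) (g t')" .
  qed
qed

section \<open>Common neighbours and \<open>\<mu>\<close>-graphs\<close>

text \<open>For \<open>B u v \<noteq> 0\<close> this is the solution \<open>w\<close> of
  \<open>B u w = 1\<close> and \<open>B v w = - r\<close>, written in the basis \<open>u\<close>,
  \<open>v\<close>.\<close>

definition mu_vec :: "'v \<Rightarrow> 'v \<Rightarrow> 'k \<Rightarrow> 'v" where
  "mu_vec u v r = (r / B u v) *s u + inverse (B u v) *s v"

lemma B_mu_vec:
  assumes "B u v \<noteq> 0"
  shows "B u (mu_vec u v r) = 1" "B v (mu_vec u v r) = - r"
    and "B (mu_vec u v r) (mu_vec u v r') = (r - r') / B u v"
  using assms B_swap[of v u] by (simp_all add: mu_vec_def field_simps)

text \<open>A common neighbour has a unique representative that pairs to 1 with \<open>u\<close>,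
  and its pairing with \<open>v\<close> is then an arbitrary element of \<open>R\<close>. The
  hypothesis also admits adjacent vertices, so the lemma yields walks of length 2 for every nonzero
  value of the form.\<close>

lemma bij_betw_mu:
  assumes uv: "B u v \<noteq> 0"
  shows "bij_betw (\<lambda>r. orb (mu_vec u v r)) R (nbhd \<Gamma> (orb u) \<inter> nbhd \<Gamma> (orb v))"
  unfolding bij_betw_def
proof
  note B_mu = B_mu_vec[OF uv]
  have nz: "mu_vec u v r \<noteq> 0" for r
    using B_mu B_nonzero_args(1)[of u "mu_vec u v r"] by simp
  have uv0: "u \<noteq> 0" "v \<noteq> 0"
    using B_nonzero_args[OF uv] by simp_all
  show "inj_on (\<lambda>r. orb (mu_vec u v r)) R"
  proof (rule inj_onI)
    fix r r'
    assume "orb (mu_vec u v r) = orb (mu_vec u v r')"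
    then obtain a where a: "mu_vec u v r' = a *s mu_vec u v r"
      by (auto simp: orb_eq_iff)
    have "a = 1"
      using arg_cong[OF a, of "B u"] B_mu by simp
    then show "r = r'"
      using arg_cong[OF a, of "B v"] B_mu by simp
  qed
  show "(\<lambda>r. orb (mu_vec u v r)) ` R = nbhd \<Gamma> (orb u) \<inter> nbhd \<Gamma> (orb v)"
  proof (intro equalityI subsetI)
    fix X
    assume "X \<in> nbhd \<Gamma> (orb u) \<inter> nbhd \<Gamma> (orb v)"
    then have X: "X \<in> verts \<Gamma>" "adj \<Gamma> (orb u) X" "adj \<Gamma> (orb v) X"
      by (simp_all add: nbhd_def)
    then obtain w where w: "w \<noteq> 0" "X = orb w"
      unfolding verts_Gamma by blast
    then have BR: "B u w \<in> R" "B v w \<in> R"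
      using uv0 X adj_orb_iff by simp_all
    define w' where "w' = inverse (B u w) *s w"
    have w': "X = orb w'" "B u w' = 1" "B v w' \<in> R"
      using w BR inverse_R nonzero_R[OF BR(1)] orb_scale mult_R by (simp_all add: w'_def)
    have "w' = mu_vec u v (B w' v)"
      using symplectic_expansion[OF uv, of w'] w' by (simp add: mu_vec_def inverse_eq_divide)
    then have "X = orb (mu_vec u v (B w' v))"
      unfolding w'(1) by (rule arg_cong)
    then show "X \<in> (\<lambda>r. orb (mu_vec u v r)) ` R"
      using w'(3) B_swap_R by blast
  next
    fix X
    assume "X \<in> (\<lambda>r. orb (mu_vec u v r)) ` R"
    then obtain r where r: "r \<in> R" "X = orb (mu_vec u v r)" by blast
    then have "B u (mu_vec u v r) \<in> R" "B v (mu_vec u v r) \<in> R"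
      using B_mu one_R by simp_all
    then show "X \<in> nbhd \<Gamma> (orb u) \<inter> nbhd \<Gamma> (orb v)"
      using uv0 nz[of r] r by (simp add: nbhd_def verts_Gamma adj_orb_iff)
  qed
qed

lemma union_of_cycles_mu_graph:
  assumes uv: "B u v \<noteq> 0" "B u v \<notin> R"
  shows "\<exists>l. union_of_cycles (mu_graph \<Gamma> (orb u) (orb v)) l"
proof (rule union_of_cycles_cayley)
  let ?M = "nbhd \<Gamma> (orb u) \<inter> nbhd \<Gamma> (orb v)"
  let ?f = "\<lambda>r. orb (mu_vec u v r)"
  have verts: "verts (mu_graph \<Gamma> (orb u) (orb v)) = ?M"
    by (auto simp: mu_graph_def induced_def nbhd_def)
  show "bij_betw ?f R (verts (mu_graph \<Gamma> (orb u) (orb v)))"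
    unfolding verts using uv(1) by (rule bij_betw_mu)
  show "x * cyc (B u v) \<in> R" if "x \<in> R" for x
    using that cyc_R[OF uv] by (rule mult_R)
  show "cyc (B u v) * cyc (B u v) \<noteq> 1"
    using uv by (rule cyc_square)
  show "adj (mu_graph \<Gamma> (orb u) (orb v)) (?f x) (?f y) \<longleftrightarrow>
      y = x * cyc (B u v) \<or> x = y * cyc (B u v)" if "x \<in> R" "y \<in> R" for x y
  proof -
    have nz: "mu_vec u v r \<noteq> 0" for r
      using B_mu_vec[OF uv(1)] B_nonzero_args(1)[of u "mu_vec u v r"] by simp
    have "?f x \<in> ?M" "?f y \<in> ?M"
      using bij_betw_mu[OF uv(1)] that by (auto simp: bij_betw_def)
    then show ?thesis
      using nz B_mu_vec(3)[OF uv(1)] diff_divide_R_iff[OF uv that]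
      by (simp add: mu_graph_def induced_def adj_orb_iff)
  qed
  show "y \<in> verts (mu_graph \<Gamma> (orb u) (orb v))" if "adj (mu_graph \<Gamma> (orb u) (orb v)) x y" for x y
    using that by (auto simp: mu_graph_def induced_def nbhd_def)
qed (simp_all add: one_R)

lemma card_verts_mu_graph:
  assumes "B u v \<noteq> 0"
  shows "card (verts (mu_graph \<Gamma> (orb u) (orb v))) = 2 * (n - 1)"
proof -
  have "verts (mu_graph \<Gamma> (orb u) (orb v)) = nbhd \<Gamma> (orb u) \<inter> nbhd \<Gamma> (orb v)"
    by (auto simp: mu_graph_def induced_def nbhd_def)
  then show ?thesis
    using bij_betw_same_card[OF bij_betw_mu[OF assms]] card_R by simp
qed

section \<open>Distances\<close>

text \<open>If \<open>v = a *s u\<close>, a common neighbour \<open>w\<close> puts both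
  \<open>B w u\<close> and \<open>a * B w u\<close> into \<open>R\<close>, which forces
  \<open>a \<in> R\<close>. So distinct orbits on one line have no common neighbour.\<close>

lemma adj_two_iff:
  assumes "u \<noteq> 0" "v \<noteq> 0"
  shows "(\<exists>Z. adj \<Gamma> (orb u) Z \<and> adj \<Gamma> Z (orb v)) \<longleftrightarrow> B u v \<noteq> 0 \<or> orb u = orb v"
proof
  assume "\<exists>Z. adj \<Gamma> (orb u) Z \<and> adj \<Gamma> Z (orb v)"
  then obtain Z where Z: "adj \<Gamma> (orb u) Z" "adj \<Gamma> Z (orb v)" by blast
  then obtain w where "w \<noteq> 0" "Z = orb w"
    using adj_Gamma_verts[OF Z(1)] by (auto simp: verts_Gamma)
  with Z have w: "B u w \<in> R" "B w v \<in> R"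
    using assms by (simp_all add: adj_orb_iff)
  show "B u v \<noteq> 0 \<or> orb u = orb v"
  proof (cases "B u v = 0")
    case True
    then obtain a where a: "v = a *s u"
      using B_eq_0_iff assms by auto
    have "B w u \<in> R"
      using w B_swap_R by simp
    moreover have "B w u * a \<in> R"
      using w by (simp add: a mult.commute)
    ultimately have "a \<in> R"
      using mult_R_iff by blast
    then show ?thesis
      unfolding a by (simp add: orb_scale)
  qed simp
next
  assume "B u v \<noteq> 0 \<or> orb u = orb v"
  then show "\<exists>Z. adj \<Gamma> (orb u) Z \<and> adj \<Gamma> Z (orb v)"
  proof
    assume "B u v \<noteq> 0"
    then have "orb (mu_vec u v 1) \<in> nbhd \<Gamma> (orb u) \<inter> nbhd \<Gamma> (orb v)"
      using bij_betw_mu one_R by (fastforce simp: bij_betw_def)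
    then show ?thesis
      using simple_graph_Gamma by (auto simp: nbhd_def simple_graph_def)
  next
    assume "orb u = orb v"
    moreover obtain w where w: "B u w = 1"
      using ex_dual assms by blast
    moreover have "w \<noteq> 0" using w by auto
    ultimately show ?thesis
      using assms one_R B_swap_R adj_orb_iff by metis
  qed
qed

lemma gdist_orb:
  assumes u: "u \<noteq> 0" and v: "v \<noteq> 0"
  shows "gdist \<Gamma> (orb u) (orb v) =
    (if orb u = orb v then 0 else if B u v \<in> R then 1 else if B u v \<noteq> 0 then 2 else 3)"
proof -
  have p0: "(adj \<Gamma> ^^ 0) (orb u) (orb v) \<longleftrightarrow> orb u = orb v"
    by simp
  have p1: "(adj \<Gamma> ^^ 1) (orb u) (orb v) \<longleftrightarrow> B u v \<in> R"
    using u v by (simp add: adj_orb_iff eq_OO)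
  \<comment> \<open>The vectors are quantified afresh because \<open>p3\<close> applies this to a
    neighbour \<open>w\<close> of \<open>u\<close> in place of \<open>u\<close>.\<close>
  have p2: "(adj \<Gamma> ^^ 2) (orb u) (orb v) \<longleftrightarrow> B u v \<noteq> 0 \<or> orb u = orb v" if "v \<noteq> 0" "u \<noteq> 0" for u v
    using adj_two_iff[OF that(2,1)] by (auto simp: numeral_2_eq_2 relcompp_apply)
  \<comment> \<open>A neighbour \<open>w\<close> of \<open>u\<close> lies off the line containing
    \<open>u\<close> and \<open>v\<close>, so \<open>B w v \<noteq> 0\<close> and two more steps
    lead to \<open>v\<close>.\<close>
  have p3: "(adj \<Gamma> ^^ 3) (orb u) (orb v)" if 0: "B u v = 0"
  proof -
    obtain w where w: "B u w = 1"
      using ex_dual u by blast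
    then have w0: "w \<noteq> 0" by auto
    obtain a where a: "v = a *s u"
      using 0 u B_eq_0_iff by auto
    have "B w v \<noteq> 0"
      using w a v B_swap[of w u] by auto
    then have "(adj \<Gamma> ^^ 2) (orb w) (orb v)"
      using p2 w0 v by simp
    moreover have "adj \<Gamma> (orb u) (orb w)"
      using w w0 u one_R by (simp add: adj_orb_iff)
    ultimately have "(adj \<Gamma> ^^ Suc 2) (orb u) (orb v)"
      by (intro relpowp_Suc_I2)
    then show ?thesis by simp
  qed
  consider "orb u = orb v" | "orb u \<noteq> orb v" "B u v \<in> R"
    | "orb u \<noteq> orb v" "B u v \<notin> R" "B u v \<noteq> 0" | "orb u \<noteq> orb v" "B u v \<notin> R" "B u v = 0"
    by blast
  then show ?thesis
  proof cases
    case 1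
    then have "gdist \<Gamma> (orb u) (orb v) = enat 0"
      using p0 by (intro gdist_eqI) auto
    with 1 show ?thesis by (simp add: zero_enat_def)
  next
    case 2
    then have "gdist \<Gamma> (orb u) (orb v) = enat 1"
      using p0 p1 by (intro gdist_eqI) auto
    with 2 show ?thesis by (simp add: one_enat_def)
  next
    case 3
    then have "gdist \<Gamma> (orb u) (orb v) = enat 2"
      using p0 p1 p2[OF v u] by (intro gdist_eqI) (auto simp: less_2_cases_iff)
    with 3 show ?thesis by (simp add: numeral_eq_enat)
  next
    case 4
    then have "gdist \<Gamma> (orb u) (orb v) = enat 3"
      using p0 p1 p2[OF v u] p3
      by (intro gdist_eqI) (auto simp: less_Suc_eq numeral_3_eq_3 numeral_2_eq_2)
    with 4 show ?thesis by (simp add: numeral_eq_enat)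
  qed
qed

lemma orb_neq_if_B_nonzero: "B u v \<noteq> 0 \<Longrightarrow> orb u \<noteq> orb v"
  by (auto simp: orb_eq_iff)

lemma gdist_eq_2_iff:
  assumes "u \<noteq> 0" "v \<noteq> 0"
  shows "gdist \<Gamma> (orb u) (orb v) = 2 \<longleftrightarrow> B u v \<noteq> 0 \<and> B u v \<notin> R"
  using assms orb_neq_if_B_nonzero by (auto simp: gdist_orb)

lemma antipodal_iff:
  assumes "u \<noteq> 0" "v \<noteq> 0"
  shows "(orb u, orb v) \<in> antipodal_rel \<Gamma> \<longleftrightarrow> B u v = 0"
  using assms orb_neq_if_B_nonzero[of u v]
  by (auto simp: antipodal_rel_def gdist_orb verts_Gamma)

lemma connected_Gamma: "connected_graph \<Gamma>"
proof -
  have "(adj \<Gamma>)\<^sup>*\<^sup>* (orb u) (orb v)" if "u \<noteq> 0" "v \<noteq> 0" for u v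
    using that by (intro rtranclp_adj_if_gdist_finite) (simp add: gdist_orb del: not_infinity_eq)
  moreover have "card (verts \<Gamma>) \<noteq> 0"
    using card_verts n_ge_3 by simp
  then have "verts \<Gamma> \<noteq> {}" by auto
  ultimately show ?thesis
    by (auto simp: connected_graph_def verts_Gamma)
qed

section \<open>Diameter and intersection numbers\<close>

lemma card_Compl_R: "card (- insert 0 R) = (n - 1)\<^sup>2"
proof -
  have "card (insert 0 R) = 2 * (n - 1) + 1"
    using card_R by simp
  then have "card (- insert 0 R) = n\<^sup>2 - (2 * (n - 1) + 1)"
    using card_UNIV by (simp add: Compl_eq_Diff_UNIV card_Diff_subset)
  moreover obtain m where "n = Suc m"
    using n_ge_3 by (cases n) auto
  ultimately show ?thesis
    by (simp add: power2_eq_square)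
qed

lemma diameter_Gamma: "diameter \<Gamma> = 3"
proof (rule antisym)
  have "gdist \<Gamma> (orb u) (orb v) \<le> 3" if "u \<noteq> 0" "v \<noteq> 0" for u v
    using that by (simp add: gdist_orb)
  then show "diameter \<Gamma> \<le> 3"
    unfolding diameter_def by (intro SUP_least) (auto simp: verts_Gamma)
  \<comment> \<open>A nonzero scalar \<open>a\<close> outside \<open>R\<close> yields two distinct
    orbits on one line, which are at distance 3.\<close>
  have "- insert 0 R \<noteq> {}"
    using card_Compl_R n_ge_3 by force
  then obtain a where a: "a \<noteq> 0" "a \<notin> R" by blast
  obtain u :: 'v where u: "u \<noteq> 0"
    using connected_Gamma by (auto simp: connected_graph_def verts_Gamma)
  have "orb u \<noteq> orb (a *s u)"
    using a u by (auto simp: orb_eq_iff)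
  then have "3 = gdist \<Gamma> (orb u) (orb (a *s u))"
    using a u by (simp add: gdist_orb)
  also have "\<dots> \<le> diameter \<Gamma>"
    unfolding diameter_def using a u by (intro SUP_upper2[of "orb u"] SUP_upper) (simp_all add: verts_Gamma)
  finally show "3 \<le> diameter \<Gamma>" .
qed

text \<open>With \<open>w = - u / B u v\<close> the neighbours of \<open>orb v\<close> are the \<open>orb (w + t v)\<close>, and
  \<open>B u (w + t v) = t * B u v\<close>.\<close>

lemma card_nbhd_at_distance:
  assumes uv: "B u v \<noteq> 0"
  shows "card {Z \<in> nbhd \<Gamma> (orb v). gdist \<Gamma> (orb u) Z = d} =
    card {t. (if t = 0 then if B u v \<in> R then 0 else 3 else if t * B u v \<in> R then 1 else 2) = d}"
proof -
  define w where "w = (- inverse (B u v)) *s u"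
  have w: "B v w = 1"
    using uv B_swap[of v u] by (simp add: w_def)
  have u: "u \<noteq> 0"
    using uv by auto
  have dist: "gdist \<Gamma> (orb u) (orb (w + t *s v)) =
      (if t = 0 then if B u v \<in> R then 0 else 3 else if t * B u v \<in> R then 1 else 2)" for t
  proof -
    have "w + t *s v \<noteq> 0"
      using w B_nonzero_args(1)[of v "w + t *s v"] by simp
    moreover have Buw: "B u (w + t *s v) = t * B u v"
      by (simp add: w_def)
    \<comment> \<open>At \<open>t = 0\<close> the vector is \<open>w\<close>, a multiple of
      \<open>u\<close>. Its coefficient \<open>- inverse (B u v)\<close> lies in \<open>R\<close>
      iff \<open>B u v\<close> does, which separates distance 0 from distance 3.\<close>
    moreover have "orb u = orb (w + t *s v) \<longleftrightarrow> t = 0 \<and> B u v \<in> R"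
    proof (cases "t = 0")
      case True
      have "orb u = orb w \<longleftrightarrow> - inverse (B u v) \<in> R"
        using u by (auto simp: orb_eq_iff w_def simp del: minus_R_iff scale_minus_left)
      also have "\<dots> \<longleftrightarrow> B u v \<in> R"
        using inverse_R[of "B u v"] inverse_R[of "inverse (B u v)"] by auto
      finally show ?thesis
        using True by simp
    next
      case False
      then show ?thesis
        using orb_neq_if_B_nonzero[of u "w + t *s v"] uv Buw by simp
    qed
    ultimately show ?thesis
      using uv u by (auto simp: gdist_orb)
  qed
  have "bij_betw (\<lambda>t. orb (w + t *s v)) {t. gdist \<Gamma> (orb u) (orb (w + t *s v)) = d}
      {Z \<in> nbhd \<Gamma> (orb v). gdist \<Gamma> (orb u) Z = d}"
    unfolding bij_betw_def
  proof
    show "inj_on (\<lambda>t. orb (w + t *s v)) {t. gdist \<Gamma> (orb u) (orb (w + t *s v)) = d}"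
      using bij_betw_imp_inj_on[OF bij_betw_nbhd[OF w]] by (rule inj_on_subset) simp
    show "(\<lambda>t. orb (w + t *s v)) ` {t. gdist \<Gamma> (orb u) (orb (w + t *s v)) = d} =
        {Z \<in> nbhd \<Gamma> (orb v). gdist \<Gamma> (orb u) Z = d}"
      unfolding bij_betw_imp_surj_on[OF bij_betw_nbhd[OF w], symmetric] by auto
  qed
  from bij_betw_same_card[OF this, symmetric] show ?thesis
    unfolding dist .
qed

text \<open>At distance 0 or 3, all neighbours of \<open>orb v\<close> are equally far from
  \<open>orb u\<close>, so \<open>card_nbhd\<close> suffices. At distance 1 or 2, the parameters
  \<open>t\<close> from \<open>card_nbhd_at_distance\<close> are counted.\<close>

lemma distance_regular_Gamma: "distance_regular \<Gamma> [n\<^sup>2, (n - 1)\<^sup>2, 1] [1, 2 * (n - 1), n\<^sup>2]"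
  (is "distance_regular \<Gamma> ?bs ?cs")
proof -
  have "(i < 3 \<longrightarrow> card {Z \<in> nbhd \<Gamma> (orb v). gdist \<Gamma> (orb u) Z = enat (i + 1)} = ?bs ! i) \<and>
     (1 \<le> i \<longrightarrow> card {Z \<in> nbhd \<Gamma> (orb v). gdist \<Gamma> (orb u) Z = enat (i - 1)} = ?cs ! (i - 1))"
    if u: "u \<noteq> 0" and v: "v \<noteq> 0" and i: "gdist \<Gamma> (orb u) (orb v) = enat i" for u v i
  proof -
    have nbhd: "Z \<in> nbhd \<Gamma> (orb v) \<longleftrightarrow> (\<exists>w. w \<noteq> 0 \<and> Z = orb w \<and> B v w \<in> R)" for Z
      using v by (auto simp: nbhd_def verts_Gamma adj_orb_iff)
    consider "orb u = orb v" | "B u v \<in> R" | "B u v \<notin> R" "B u v \<noteq> 0"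
      | "orb u \<noteq> orb v" "B u v = 0"
      by blast
    then show ?thesis
    proof cases
      case 1
      have "i = 0"
        using i 1 u v by (simp add: gdist_orb zero_enat_def)
      then have e: "enat (i + 1) = 1"
        by (simp add: one_enat_def)
      have "gdist \<Gamma> (orb v) (orb w) = 1" if "w \<noteq> 0" "B v w \<in> R" for w
        using that v nonzero_R orb_neq_if_B_nonzero[of v w] by (auto simp: gdist_orb)
      then have "{Z \<in> nbhd \<Gamma> (orb v). gdist \<Gamma> (orb u) Z = 1} = nbhd \<Gamma> (orb v)"
        unfolding 1 by (auto simp: nbhd)
      with \<open>i = 0\<close> show ?thesis
        unfolding e using card_nbhd[OF v] by simp
    next
      case 2
      then have uv: "B u v \<noteq> 0"
        using nonzero_R by blast
      have "i = 1"
        using i 2 u v orb_neq_if_B_nonzero[OF uv] by (simp add: gdist_orb one_enat_def)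
      then have e: "enat (i + 1) = 2" "enat (i - 1) = 0"
        by (simp_all add: numeral_eq_enat zero_enat_def)
      \<comment> \<open>As \<open>B u v \<in> R\<close>, the condition
        \<open>t * B u v \<in> R\<close> amounts to \<open>t \<in> R\<close>; distance 2 is left for
        the parameters outside \<open>R\<close> and 0.\<close>
      have "{t. (if t = 0 then 0 else if t * B u v \<in> R then 1 else 2) = (2 :: enat)} = - insert 0 R"
        using mult_R_iff[OF 2] by (auto simp: mult.commute)
      moreover have "{t. (if t = 0 then 0 else if t * B u v \<in> R then 1 else 2) = (0 :: enat)} = {0}"
        by auto
      ultimately show ?thesis
        unfolding e card_nbhd_at_distance[OF uv] using 2 card_Compl_R \<open>i = 1\<close> by simp
    next
      case 3
      have "i = 2"
        using i 3 u v orb_neq_if_B_nonzero by (simp add: gdist_orb numeral_eq_enat)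
      then have e: "enat (i + 1) = 3" "enat (i - 1) = 1"
        by (simp_all add: numeral_eq_enat one_enat_def)
      have "{t. (if t = 0 then 3 else if t * B u v \<in> R then 1 else 2) = (3 :: enat)} = {0}"
        by auto
      moreover have "{t. (if t = 0 then 3 else if t * B u v \<in> R then 1 else 2) = (1 :: enat)} = (\<lambda>r. r / B u v) ` R"
        using 3 by (auto intro!: image_eqI[of _ _ "_ * B u v"])
      moreover have "card ((\<lambda>r. r / B u v) ` R) = 2 * (n - 1)"
        using 3 card_R by (subst card_image) (auto simp: inj_on_def)
      ultimately show ?thesis
        unfolding e card_nbhd_at_distance[OF 3(2)] using 3 \<open>i = 2\<close> by simp
    next
      case 4
      have "i = 3"
        using i 4 u v by (simp add: gdist_orb numeral_eq_enat)
      then have e: "enat (i - 1) = 2"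
        by (simp add: numeral_eq_enat)
      obtain a where a: "v = a *s u"
        using 4 u B_eq_0_iff by auto
      have aR: "a \<notin> R"
        using 4 orb_scale by (auto simp: a)
      \<comment> \<open>With \<open>v = a *s u\<close> and \<open>a \<notin> R\<close>, the
        membership \<open>a * B u w \<in> R\<close> keeps \<open>B u w\<close> nonzero and outside
        \<open>R\<close>.\<close>
      have "gdist \<Gamma> (orb u) (orb w) = 2" if "w \<noteq> 0" "B v w \<in> R" for w
      proof -
        have "a * B u w \<in> R"
          using that by (simp add: a)
        then have "B u w \<noteq> 0" "B u w \<notin> R"
          using aR mult_R_iff[of "B u w" a] by (auto simp: mult.commute)
        then show ?thesis
          using u that by (simp add: gdist_eq_2_iff)
      qed
      then have "{Z \<in> nbhd \<Gamma> (orb v). gdist \<Gamma> (orb u) Z = 2} = nbhd \<Gamma> (orb v)"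
        by (auto simp: nbhd)
      with \<open>i = 3\<close> show ?thesis
        unfolding e using card_nbhd[OF v] by simp
    qed
  qed
  then show ?thesis
    using connected_Gamma diameter_Gamma
    by (auto simp: distance_regular_def verts_Gamma numeral_eq_enat)
qed

section \<open>Antipodal classes and the quotient\<close>

text \<open>By \<open>antipodal_iff\<close> the relation is the vanishing of \<open>B\<close>, that
  is, proportionality of representatives.\<close>

lemma equiv_antipodal: "equiv (verts \<Gamma>) (antipodal_rel \<Gamma>)"
proof (rule equivI)
  show "antipodal_rel \<Gamma> \<subseteq> verts \<Gamma> \<times> verts \<Gamma>"
    by (auto simp: antipodal_rel_def)
  show "refl_on (verts \<Gamma>) (antipodal_rel \<Gamma>)"
    by (auto simp: refl_on_def antipodal_rel_def)
  have iff: "(X, Y) \<in> antipodal_rel \<Gamma> \<longleftrightarrow>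
      (\<exists>u v. u \<noteq> 0 \<and> v \<noteq> 0 \<and> X = orb u \<and> Y = orb v \<and> B u v = 0)" for X Y
  proof
    assume XY: "(X, Y) \<in> antipodal_rel \<Gamma>"
    then obtain u v where "u \<noteq> 0" "v \<noteq> 0" "X = orb u" "Y = orb v"
      by (auto simp: antipodal_rel_def verts_Gamma)
    then show "\<exists>u v. u \<noteq> 0 \<and> v \<noteq> 0 \<and> X = orb u \<and> Y = orb v \<and> B u v = 0"
      using XY antipodal_iff by blast
  qed (auto simp: antipodal_iff)
  show "sym (antipodal_rel \<Gamma>)"
    unfolding sym_def iff using B_swap by (metis neg_equal_0_iff_equal)
  show "trans (antipodal_rel \<Gamma>)"
  proof (rule transI)
    fix X Y Z
    assume XY: "(X, Y) \<in> antipodal_rel \<Gamma>" and YZ: "(Y, Z) \<in> antipodal_rel \<Gamma>"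
    obtain u v where uv: "u \<noteq> 0" "v \<noteq> 0" "X = orb u" "Y = orb v" "B u v = 0"
      using XY unfolding iff by blast
    obtain w where w: "w \<noteq> 0" "Z = orb w"
      using YZ unfolding iff by blast
    then have "B v w = 0"
      using YZ uv antipodal_iff by simp
    then obtain a b where "v = a *s u" "w = b *s v"
      using uv B_eq_0_iff by blast
    then have "B u w = 0" by simp
    then show "(X, Z) \<in> antipodal_rel \<Gamma>"
      using uv w antipodal_iff by simp
  qed
qed

text \<open>The class of \<open>orb u\<close> consists of the orbits on the punctured line through
  \<open>u\<close>, which has \<open>n\<^sup>2 - 1\<close> points.\<close>

lemma card_antipodal_class:
  assumes "X \<in> verts \<Gamma> // antipodal_rel \<Gamma>"
  shows "card X = (n + 1) div 2"
proof -
  obtain u where u: "u \<noteq> 0" and X: "X = antipodal_rel \<Gamma> `` {orb u}"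
    using assms by (auto simp: quotient_def verts_Gamma)
  define S where "S = (\<lambda>a. a *s u) ` (UNIV - {0})"
  have "X = orb ` S"
  proof (intro equalityI subsetI)
    fix Y
    assume "Y \<in> X"
    then have Y: "(orb u, Y) \<in> antipodal_rel \<Gamma>"
      by (simp add: X)
    then obtain v where v: "v \<noteq> 0" "Y = orb v"
      by (auto simp: antipodal_rel_def verts_Gamma)
    then obtain a where "v = a *s u"
      using Y u antipodal_iff B_eq_0_iff by blast
    then show "Y \<in> orb ` S"
      using v by (auto simp: S_def)
  next
    fix Y
    assume "Y \<in> orb ` S"
    then obtain a where "a \<noteq> 0" "Y = orb (a *s u)"
      by (auto simp: S_def)
    then show "Y \<in> X"
      using u by (simp add: X antipodal_iff)
  qed
  moreover have "card R * card (orb ` S) = card S"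
    using u nonzero_R by (intro card_orb_partition) (auto simp: S_def mem_orb_iff)
  moreover have "card S = n\<^sup>2 - 1"
    unfolding S_def using u card_nonzero_K by (subst card_image) (auto simp: inj_on_def)
  ultimately have "card R * card X = card R * ((n + 1) div 2)"
    using half_n_times_card_R by (simp add: mult.commute)
  then show ?thesis
    using card_R n_ge_3 by simp
qed

text \<open>The vertex count divided by the common class size; the classes correspond to the lines
  of the plane.\<close>

lemma card_antipodal_quotient: "card (verts \<Gamma> // antipodal_rel \<Gamma>) = n\<^sup>2 + 1"
proof -
  let ?Q = "verts \<Gamma> // antipodal_rel \<Gamma>"
  have fin: "finite (verts \<Gamma>)"
    by (simp add: verts_Gamma)
  have "(n + 1) div 2 * card ?Q = card (\<Union> ?Q)"
  proof (rule card_partition)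
    show "finite ?Q"
      using fin by (simp add: quotient_def)
    show "finite (\<Union> ?Q)"
      using fin Union_quotient[OF equiv_antipodal] by simp
    show "X \<inter> Y = {}" if "X \<in> ?Q" "Y \<in> ?Q" "X \<noteq> Y" for X Y
      using quotient_disj[OF equiv_antipodal that(1,2)] that(3) by blast
  qed (rule card_antipodal_class)
  also have "\<dots> = (n + 1) div 2 * (n\<^sup>2 + 1)"
    using Union_quotient[OF equiv_antipodal] card_verts by (simp add: mult.commute)
  finally show ?thesis
    using n_ge_3 by (simp only: mult_cancel1) auto
qed

lemma quotient_complete:
  "graph_iso (quotient_graph \<Gamma> (antipodal_rel \<Gamma>)) (complete_graph (n\<^sup>2 + 1))"
proof -
  let ?E = "antipodal_rel \<Gamma>"
  let ?Q = "verts \<Gamma> // ?E"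
  have "finite ?Q"
    by (simp add: quotient_def verts_Gamma)
  then obtain h where h: "bij_betw h ?Q {1..n\<^sup>2 + 1}"
    using finite_same_card_bij[of ?Q "{1..n\<^sup>2 + 1}"] card_antipodal_quotient by auto
  have adj: "\<exists>x\<in>X. \<exists>y\<in>Y. adj \<Gamma> x y" if XY: "X \<in> ?Q" "Y \<in> ?Q" "X \<noteq> Y" for X Y
  proof -
    obtain u v where uv: "u \<noteq> 0" "v \<noteq> 0" "X = ?E `` {orb u}" "Y = ?E `` {orb v}"
      using XY by (auto simp: quotient_def verts_Gamma)
    then have "(orb u, orb v) \<notin> ?E"
      using equiv_class_eq[OF equiv_antipodal] XY(3) by blast
    then have B: "B u v \<noteq> 0"
      using uv antipodal_iff by simp
    \<comment> \<open>Moving along the line of \<open>v\<close> stays in the class \<open>Y\<close>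
      and reaches a vector that pairs to 1 with \<open>u\<close>.\<close>
    define w where "w = inverse (B u v) *s v"
    have w: "w \<noteq> 0" "B u w = 1" "B v w = 0"
      using B uv by (simp_all add: w_def)
    then have "orb u \<in> X" "orb w \<in> Y"
      using uv antipodal_iff by simp_all
    moreover have "adj \<Gamma> (orb u) (orb w)"
      using uv w one_R by (simp add: adj_orb_iff)
    ultimately show ?thesis by blast
  qed
  have "h X \<in> {1..n\<^sup>2 + 1}" "h X = h Y \<longleftrightarrow> X = Y" if "X \<in> ?Q" "Y \<in> ?Q" for X Y
    using h that by (auto simp: bij_betw_def inj_on_eq_iff)
  then have "adj (quotient_graph \<Gamma> ?E) X Y \<longleftrightarrow> adj (complete_graph (n\<^sup>2 + 1)) (h X) (h Y)"
    if "X \<in> ?Q" "Y \<in> ?Q" for X Y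
    using adj[OF that] that unfolding quotient_graph_def complete_graph_def graph.sel by metis
  then show ?thesis
    using h unfolding graph_iso_def
    by (intro exI[of _ h]) (simp add: quotient_graph_def complete_graph_def)
qed

lemma antipodal_cover_Gamma: "antipodal_cover \<Gamma> ((n + 1) div 2) (n\<^sup>2 + 1)"
  unfolding antipodal_cover_def
  using distance_regular_Gamma diameter_Gamma equiv_antipodal card_antipodal_class quotient_complete
  by blast

end

theorem theorem1p2:
  fixes n p k :: nat
    and scale :: "'k::field \<Rightarrow> 'v::ab_group_add \<Rightarrow> 'v"
    and B :: "'v \<Rightarrow> 'v \<Rightarrow> 'k"
    and R :: "'k set"
  assumes "prime p" and "odd p" and "k \<ge> 1" and "n = p ^ k"
    and "card (UNIV :: 'k set) = n\<^sup>2"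
    and "vector_space scale" and "vector_space.dim scale UNIV = 2"
    and "symplectic_form scale B"
    and "subgroup R mult_group" and "card (rcosets\<^bsub>mult_group\<^esub> R) = (n + 1) div 2"
  defines "\<Gamma> \<equiv> Gamma scale B R"
  shows "simple_graph \<Gamma> \<and>
    connected_graph \<Gamma> \<and>
    locally_grid \<Gamma> n \<and>
    (\<forall>x\<in>verts \<Gamma>. \<forall>y\<in>verts \<Gamma>. gdist \<Gamma> x y = 2 \<longrightarrow>
       card (verts (mu_graph \<Gamma> x y)) = 2 * (n - 1)) \<and>
    card (verts \<Gamma>) = (n\<^sup>2 + 1) * (n + 1) div 2 \<and>
    diameter \<Gamma> = 3 \<and>
    distance_regular \<Gamma> [n\<^sup>2, (n - 1)\<^sup>2, 1] [1, 2 * (n - 1), n\<^sup>2] \<and>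
    antipodal_cover \<Gamma> ((n + 1) div 2) (n\<^sup>2 + 1) \<and>
    (\<forall>x\<in>verts \<Gamma>. \<forall>y\<in>verts \<Gamma>. gdist \<Gamma> x y = 2 \<longrightarrow>
       connected_graph (mu_graph \<Gamma> x y) \<or> (\<exists>l. union_of_cycles (mu_graph \<Gamma> x y) l))"
proof -
  interpret symplectic_plane n p k R scale B
    using assms(1-10)
    by (intro symplectic_plane.intro quadratic_subgroup.intro symplectic_plane_axioms.intro)
  \<comment> \<open>Of the two alternatives for a \<open>\<mu>\<close>-graph in the conclusion, the
    union of cycles is the one established.\<close>
  have mu: "card (verts (mu_graph \<Gamma> X Y)) = 2 * (n - 1) \<and> (\<exists>l. union_of_cycles (mu_graph \<Gamma> X Y) l)"
    if XY: "X \<in> verts \<Gamma>" "Y \<in> verts \<Gamma>" and dist: "gdist \<Gamma> X Y = 2" for X Y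
  proof -
    obtain u v where uv: "u \<noteq> 0" "v \<noteq> 0" "X = orb u" "Y = orb v"
      using XY unfolding \<Gamma>_def verts_Gamma by blast
    then have "B u v \<noteq> 0" "B u v \<notin> R"
      using dist by (simp_all add: \<Gamma>_def gdist_eq_2_iff)
    then show ?thesis
      using card_verts_mu_graph union_of_cycles_mu_graph uv by (simp add: \<Gamma>_def)
  qed
  \<comment> \<open>The conclusion halves the whole product, \<open>card_verts\<close> only the
    factor \<open>n + 1\<close>; they agree because this factor is even.\<close>
  have "even (n + 1)"
    using odd_n by simp
  then have "card (verts \<Gamma>) = (n\<^sup>2 + 1) * (n + 1) div 2"
    unfolding \<Gamma>_def card_verts by (rule div_mult_swap)
  then show ?thesis
    using mu simple_graph_Gamma connected_Gamma locally_grid_Gamma diameter_Gamma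
      distance_regular_Gamma antipodal_cover_Gamma
    unfolding \<Gamma>_def by blast
qed

end
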